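(* Let $n>5f$. The convergence algorithm described in the context, executed by $n$ robots of which at most $f$ are Byzantine, in the CORDA model under a fully asynchronous scheduler, is shrinking. That is, there exists $\alpha\in(0,1)$ such that for every time $t$ there is a time $t'>t$ with $$diam\big(U(t')\cup D(t')\big)<\alpha\cdot diam\big(U(t)\cup D(t)\big),$$ where $U(t)$ and $D(t)$ are the multisets of positions and of destinations of the correct robots at time $t$, and $diam(S)=\max S-\min S$.
   Context: Setting: $n$ robots on the real line, at most $f$ Byzantine (arbitrary behaviour, positions chosen by an adversary). Robots are anonymous, oblivious, have no common orientation, and have unlimited visibility with strong multiplicity detection. Correct robots run Look–Compute–Move cycles. In the CORDA model, phases of different robots interleave arbitrarily, so computations may use outdated snapshots. The adversary may stop robot $i$ during a Move only after it has moved at least $\delta_i>0$ toward its destination or reached it. The fully asynchronous scheduler only guarantees that each robot is activated infinitely often. Algorithm: with snapshot sorted $P_1\le\dots\le P_n$ and own position $x_i$, robot $i$ is elected iff $x_i\le P_{f+1}$ or $x_i\ge P_{n-f}$. If elected, it moves toward the midpoint of $\min(x_i,P_{2f+1})$ and $\max(x_i,P_{n-2f})$, which is the center of $trim^i_{2f}(P)$ (remove, among the $2f$ smallest positions, those below $x_i$, and, among the $2f$ largest positions, those above $x_i$). A non-elected robot does not move. The destination of a correct robot at time $t$ is the last destination it computed at or before $t$ (its position if none). *)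

theory Defs
  imports Complex_Main "HOL-Library.Multiset"
begin

text \<open>Time is real, executions start at time 0.
  pos j t is the position of robot j at time t (Byzantine robots: arbitrary).
  For a correct robot i, its k-th Look-Compute-Move cycle has
  Look at time look i k, Compute (and start of Move) at time cmp i k,
  end of Move at time mend i k.\<close>

text \<open>The k-th smallest position (1-indexed) of a sorted snapshot list.\<close>
definition Pk :: "real list \<Rightarrow> nat \<Rightarrow> real" where
  "Pk P k = P ! (k - 1)"

definition algo :: "nat \<Rightarrow> nat \<Rightarrow> real list \<Rightarrow> real \<Rightarrow> real" where
  "algo n f P x =
     (if x \<le> Pk P (f + 1) \<or> x \<ge> Pk P (n - f)
      then (min x (Pk P (2 * f + 1)) + max x (Pk P (n - 2 * f))) / 2
      else x)"

definition snapshot :: "nat \<Rightarrow> (nat \<Rightarrow> real \<Rightarrow> real) \<Rightarrow> real \<Rightarrow> real list" where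
  "snapshot n pos t = sort (map (\<lambda>j. pos j t) [0..<n])"

definition cdest :: "nat \<Rightarrow> nat \<Rightarrow> (nat \<Rightarrow> real \<Rightarrow> real) \<Rightarrow> (nat \<Rightarrow> nat \<Rightarrow> real)
                     \<Rightarrow> nat \<Rightarrow> nat \<Rightarrow> real" where
  "cdest n f pos look i k = algo n f (snapshot n pos (look i k)) (pos i (look i k))"

definition corda_exec ::
  "nat \<Rightarrow> nat \<Rightarrow> nat set \<Rightarrow> (nat \<Rightarrow> real) \<Rightarrow> (nat \<Rightarrow> real \<Rightarrow> real)
   \<Rightarrow> (nat \<Rightarrow> nat \<Rightarrow> real) \<Rightarrow> (nat \<Rightarrow> nat \<Rightarrow> real) \<Rightarrow> (nat \<Rightarrow> nat \<Rightarrow> real) \<Rightarrow> bool" where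
  "corda_exec n f B \<delta> pos look cmp mend \<longleftrightarrow>
    (\<forall>i \<in> {..<n} - B.
       0 < \<delta> i \<and>
       0 \<le> look i 0 \<and>
       (\<forall>k. look i k \<le> cmp i k \<and> cmp i k \<le> mend i k \<and> mend i k \<le> look i (Suc k)) \<and>
       (\<forall>T. \<exists>k. T < look i k) \<and>
       (\<forall>t. 0 \<le> t \<and> t \<le> cmp i 0 \<longrightarrow> pos i t = pos i 0) \<and>
       (\<forall>k t. mend i k \<le> t \<and> t \<le> cmp i (Suc k) \<longrightarrow> pos i t = pos i (mend i k)) \<and>
       (\<forall>k. let s = pos i (cmp i k); d = cdest n f pos look i k in
          (\<exists>lam :: real \<Rightarrow> real. mono_on {cmp i k..mend i k} lam \<and>
             (\<forall>t \<in> {cmp i k..mend i k}. 0 \<le> lam t \<and> lam t \<le> 1 \<and> pos i t = s + lam t * (d - s))) \<and>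
          (pos i (mend i k) = d \<or> \<bar>pos i (mend i k) - s\<bar> \<ge> \<delta> i)))"

definition dest_at :: "nat \<Rightarrow> nat \<Rightarrow> (nat \<Rightarrow> real \<Rightarrow> real) \<Rightarrow> (nat \<Rightarrow> nat \<Rightarrow> real)
                       \<Rightarrow> (nat \<Rightarrow> nat \<Rightarrow> real) \<Rightarrow> nat \<Rightarrow> real \<Rightarrow> real" where
  "dest_at n f pos look cmp i t =
     (if \<exists>k. cmp i k \<le> t then cdest n f pos look i (GREATEST k. cmp i k \<le> t) else pos i t)"

definition U_ms :: "nat \<Rightarrow> nat set \<Rightarrow> (nat \<Rightarrow> real \<Rightarrow> real) \<Rightarrow> real \<Rightarrow> real multiset" where
  "U_ms n B pos t = image_mset (\<lambda>i. pos i t) (mset_set ({..<n} - B))"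

definition D_ms :: "nat \<Rightarrow> nat \<Rightarrow> nat set \<Rightarrow> (nat \<Rightarrow> real \<Rightarrow> real) \<Rightarrow> (nat \<Rightarrow> nat \<Rightarrow> real)
                    \<Rightarrow> (nat \<Rightarrow> nat \<Rightarrow> real) \<Rightarrow> real \<Rightarrow> real multiset" where
  "D_ms n f B pos look cmp t = image_mset (\<lambda>i. dest_at n f pos look cmp i t) (mset_set ({..<n} - B))"

definition diam :: "real multiset \<Rightarrow> real" where
  "diam S = Max (set_mset S) - Min (set_mset S)"

definition diamUD where
  "diamUD n f B pos look cmp t = diam (U_ms n B pos t + D_ms n f B pos look cmp t)"

end

theory Submission
  imports Defs
begin

text \<open>
  For a correct robot i let low i t be the lowest point it can reach without taking a new
  snapshot: the minimum of its position, its current destination and the destination it will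
  compute from a Look already taken. Because the algorithm discards the 2f lowest positions, a
  robot whose snapshot has at most 2f positions below a level y computes a destination at least
  min x y. Hence a lower bound on a group of correct robots persists as long as at most f of the
  correct robots lie below it; in particular the minimum of low over the correct robots is
  nondecreasing and tends to a limit a, while the levels y below which eventually at most f
  correct robots remain have a supremum a' >= a. If a < a', the robots staying at or below a form
  a fixed group from some time on; they must eventually stop moving, and the lowest of them then
  sees at most f robots below itself and moves up, a contradiction. So a = a', and by the symmetry
  x |-> -x the same holds for the upper side, with limit b. If a < b, more than f correct robots
  cluster near each end, the robots in between freeze, and at suitable late times both at most 2f
  correct robots lie above a + 3e and at most 2f lie below b - 3e, giving more than 4f correct
  robots at most 4f. Thus the spread of positions and destinations tends to 0, and any
  alpha in (0,1), e.g. 1/2, witnesses shrinking.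
\<close>

text \<open>Reflection of the line: the algorithm commutes with it (algo_mirror), so every statement about
  the lower end of the configuration, applied to the mirrored run, yields one about the upper end.\<close>

definition mirror :: "(nat \<Rightarrow> real \<Rightarrow> real) \<Rightarrow> nat \<Rightarrow> real \<Rightarrow> real" where
  "mirror pos = (\<lambda>j t. - pos j t)"

lemma affine_point_between:
  fixes s d l l' :: real
  assumes "0 \<le> l" "l \<le> l'" "l' \<le> 1"
  shows "min (s + l*(d-s)) d \<le> s + l'*(d-s) \<and> s + l'*(d-s) \<le> max (s + l*(d-s)) d"
proof (cases "s \<le> d")
  case True
  have h1: "l*(d-s) \<le> l'*(d-s)" using assms True by (intro mult_right_mono) auto
  have h2: "l'*(d-s) \<le> d-s" using mult_right_mono[of l' 1 "d-s"] assms True by simp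
  have "s + l*(d-s) \<le> s + l'*(d-s)" using h1 by linarith
  moreover have "s + l'*(d-s) \<le> d" using h2 by linarith
  ultimately show ?thesis by (simp add: min_le_iff_disj le_max_iff_disj)
next
  case False
  have h1: "l'*(s-d) \<ge> l*(s-d)" using assms False by (intro mult_right_mono) auto
  have h2: "l'*(s-d) \<le> s-d" using mult_right_mono[of l' 1 "s-d"] assms False by simp
  have e1: "l*(d-s) = - (l*(s-d))" "l'*(d-s) = - (l'*(s-d))" by (simp_all add: algebra_simps)
  have "s + l'*(d-s) \<le> s + l*(d-s)" using h1 e1 by linarith
  moreover have "d \<le> s + l'*(d-s)" using h2 e1 by linarith
  ultimately show ?thesis by (simp add: min_le_iff_disj le_max_iff_disj)
qed

lemma shrinking_filter_stabilizes:
  fixes P :: "'a \<Rightarrow> real \<Rightarrow> bool"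
  assumes fin: "finite A"
    and shrink: "\<And>i t t'. T \<le> t \<Longrightarrow> t \<le> t' \<Longrightarrow> i \<in> A \<Longrightarrow> P i t' \<Longrightarrow> P i t"
    and card: "\<And>t. T \<le> t \<Longrightarrow> q \<le> card {i\<in>A. P i t}"
  shows "\<exists>T'\<ge>T. \<exists>S. S \<subseteq> A \<and> q \<le> card S \<and> (\<forall>t\<ge>T'. \<forall>i\<in>A. i \<in> S \<longleftrightarrow> P i t)"
proof -
  define S where "S t = {i\<in>A. P i t}" for t
  define c0 where "c0 = (LEAST c. \<exists>t\<ge>T. card (S t) = c)"
  have "\<exists>t\<ge>T. card (S t) = c0"
    unfolding c0_def by (rule LeastI_ex) blast
  then obtain t0 where t0: "T \<le> t0" "card (S t0) = c0" by auto
  have c0_le: "c0 \<le> card (S t)" if "T \<le> t" for t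
    unfolding c0_def by (rule Least_le) (use that in blast)
  have sub: "S t \<subseteq> S t0" if "t0 \<le> t" for t
    using shrink t0(1) that unfolding S_def by blast
  have fin0: "finite (S t0)" using fin unfolding S_def by simp
  have "S t = S t0" if "t0 \<le> t" for t
  proof (rule card_subset_eq[OF fin0 sub[OF that]])
    show "card (S t) = card (S t0)"
      using card_mono[OF fin0 sub[OF that]] c0_le[of t] t0 that by simp
  qed
  then have "S t0 \<subseteq> A \<and> q \<le> card (S t0) \<and> (\<forall>t\<ge>t0. \<forall>i\<in>A. i \<in> S t0 \<longleftrightarrow> P i t)"
    using card[OF t0(1)] unfolding S_def by blast
  then show ?thesis using t0(1) by blast
qed

lemma sorted_nth_downward_iff:
  fixes xs :: "'a::linorder list"
  assumes "sorted xs" "i < length xs" and down: "\<And>x y. x \<le> y \<Longrightarrow> Q y \<Longrightarrow> Q x"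
  shows "Q (xs ! i) \<longleftrightarrow> i < length (filter Q xs)"
  using assms(1,2)
proof (induction xs arbitrary: i)
  case Nil
  then show ?case by simp
next
  case (Cons a xs)
  show ?case
  proof (cases "Q a")
    case True
    then show ?thesis using Cons by (cases i) auto
  next
    case False
    have "a \<le> v" if "v \<in> set (a # xs)" for v using Cons.prems(1) that by auto
    then have "\<not> Q v" if "v \<in> set (a # xs)" for v using down False that by blast
    then show ?thesis using nth_mem[OF Cons.prems(2)] by (auto simp: filter_empty_conv)
  qed
qed

lemma length_filter_snapshot:
  "length (filter Q (snapshot n pos t)) = card {j. j < n \<and> Q (pos j t)}"
proof -
  have "length (filter Q (snapshot n pos t)) = length (filter Q (map (\<lambda>j. pos j t) [0..<n]))"
    unfolding snapshot_def by (simp add: filter_sort)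
  also have "\<dots> = length (filter (\<lambda>j. Q (pos j t)) [0..<n])"
    by (simp add: filter_map comp_def)
  also have "\<dots> = card {j. j < n \<and> Q (pos j t)}"
  proof -
    have "{i. i < n \<and> Q (pos ([0..<n] ! i) t)} = {j. j < n \<and> Q (pos j t)}" by auto
    then show ?thesis by (simp add: length_filter_conv_card)
  qed
  finally show ?thesis .
qed

lemma length_snapshot: "length (snapshot n pos t) = n" unfolding snapshot_def by simp
lemma sorted_snapshot: "sorted (snapshot n pos t)" unfolding snapshot_def by simp

lemma Pk_snapshot_downward_iff:
  assumes "1 \<le> k" "k \<le> n" and down: "\<And>x y. x \<le> y \<Longrightarrow> Q y \<Longrightarrow> Q x"
  shows "Q (Pk (snapshot n pos t) k) \<longleftrightarrow> k \<le> card {j. j < n \<and> Q (pos j t)}"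
  using sorted_nth_downward_iff[OF sorted_snapshot, of "k - 1" n pos t Q] down
    length_filter_snapshot[of Q n pos t] length_snapshot[of n pos t] assms
  unfolding Pk_def by auto

lemma Pk_snapshot_less_iff:
  assumes "1 \<le> k" "k \<le> n"
  shows "Pk (snapshot n pos t) k < y \<longleftrightarrow> k \<le> card {j. j < n \<and> pos j t < y}"
  by (rule Pk_snapshot_downward_iff[OF assms]) simp

lemma Pk_snapshot_le_iff:
  assumes "1 \<le> k" "k \<le> n"
  shows "Pk (snapshot n pos t) k \<le> y \<longleftrightarrow> k \<le> card {j. j < n \<and> pos j t \<le> y}"
  by (rule Pk_snapshot_downward_iff[OF assms]) simp

lemma algo_ge_half_low: "(x + min x (Pk P (2*f+1)))/2 \<le> algo n f P x"
proof -
  have "(x + min x (Pk P (2*f+1)))/2 \<le> (min x (Pk P (2 * f + 1)) + max x (Pk P (n - 2 * f))) / 2"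
    by (simp add: add.commute)
  moreover have "(x + min x (Pk P (2*f+1)))/2 \<le> x" by simp
  ultimately show ?thesis unfolding algo_def by simp
qed

lemma algo_few_below:
  assumes n_gt_5f: "5*f < n" and c: "card {j. j<n \<and> pos j t < x} \<le> f"
  shows "x \<le> algo n f (snapshot n pos t) x \<and>
         (x + Pk (snapshot n pos t) (n-2*f))/2 \<le> algo n f (snapshot n pos t) x"
proof -
  let ?P = "snapshot n pos t"
  have e: "x \<le> Pk ?P (f+1)" using Pk_snapshot_less_iff[of "f+1" n pos t x] n_gt_5f c by linarith
  have r: "x \<le> Pk ?P (2*f+1)" using Pk_snapshot_less_iff[of "2*f+1" n pos t x] n_gt_5f c by linarith
  have "algo n f ?P x = (x + max x (Pk ?P (n - 2 * f))) / 2"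
    unfolding algo_def using e r by (simp add: min_def)
  then show ?thesis by simp
qed

lemma algo_ge_if_not_top:
  assumes n_gt_5f: "5*f < n" and c: "card {j. j<n \<and> pos j t \<le> x} < n - f"
  shows "x \<le> algo n f (snapshot n pos t) x"
proof -
  let ?P = "snapshot n pos t"
  have h: "\<not> Pk ?P (n-f) \<le> x" using Pk_snapshot_le_iff[of "n-f" n pos t x] n_gt_5f c by simp
  show ?thesis
  proof (cases "x \<le> Pk ?P (f+1)")
    case True
    then have "card {j. j<n \<and> pos j t < x} \<le> f" using Pk_snapshot_less_iff[of "f+1" n pos t x] n_gt_5f by linarith
    then show ?thesis using algo_few_below[OF n_gt_5f] by blast
  next
    case False
    then show ?thesis using h unfolding algo_def by simp
  qed
qed

lemma algo_le_if_not_bottom: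
  assumes n_gt_5f: "5*f < n" and c: "f < card {j. j<n \<and> pos j t < x}"
  shows "algo n f (snapshot n pos t) x \<le> x"
proof -
  let ?P = "snapshot n pos t"
  have h: "Pk ?P (f+1) < x" using Pk_snapshot_less_iff[of "f+1" n pos t x] n_gt_5f c by simp
  show ?thesis
  proof (cases "Pk ?P (n-f) \<le> x")
    case True
    then have "n - f \<le> card {j. j<n \<and> pos j t \<le> x}" using Pk_snapshot_le_iff[of "n-f" n pos t x] n_gt_5f by simp
    then have "Pk ?P (n-2*f) \<le> x" using Pk_snapshot_le_iff[of "n-2*f" n pos t x] n_gt_5f by simp
    then have "algo n f ?P x = (min x (Pk ?P (2 * f + 1)) + x) / 2"
      unfolding algo_def using True by (simp add: max_def)
    then show ?thesis by simp
  next
    case False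
    then show ?thesis using h unfolding algo_def by simp
  qed
qed

lemma algo_idle:
  assumes n_gt_5f: "5*f < n" and c1: "f < card {j. j<n \<and> pos j t < x}"
    and c2: "card {j. j<n \<and> pos j t \<le> x} < n - f"
  shows "algo n f (snapshot n pos t) x = x"
  using algo_le_if_not_bottom[of f n pos t x] algo_ge_if_not_top[of f n pos t x] n_gt_5f c1 c2 by simp

lemma Pk_low_trim_ge:
  assumes n_gt_5f: "5*f < n" and c: "card {j. j<n \<and> pos j t < y} \<le> 2*f"
  shows "y \<le> Pk (snapshot n pos t) (2*f+1)"
  using Pk_snapshot_less_iff[of "2*f+1" n pos t y] n_gt_5f c by linarith

lemma Pk_high_trim_ge:
  assumes n_gt_5f: "5*f < n" and c: "card {j. j<n \<and> pos j t < y} < n - 2*f"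
  shows "y \<le> Pk (snapshot n pos t) (n-2*f)"
  using Pk_snapshot_less_iff[of "n-2*f" n pos t y] n_gt_5f c by linarith

lemma Pk_high_trim_less:
  assumes n_gt_5f: "5*f < n" and c: "Pk (snapshot n pos t) (n-2*f) < y"
  shows "n - 2*f \<le> card {j. j<n \<and> pos j t < y}"
  using Pk_snapshot_less_iff[of "n-2*f" n pos t y] n_gt_5f c by simp

lemma sorted_rev_uminus:
  fixes P :: "real list"
  shows "sorted P \<Longrightarrow> sorted (rev (map uminus P))"
  by (simp add: sorted_wrt_rev sorted_wrt_map)

lemma snapshot_mirror: "snapshot n (mirror pos) t = rev (map uminus (snapshot n pos t))"
proof -
  have "sort (map (\<lambda>j. - pos j t) [0..<n]) = rev (map uminus (sort (map (\<lambda>j. pos j t) [0..<n])))"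
  proof (rule properties_for_sort)
    show "mset (rev (map uminus (sort (map (\<lambda>j. pos j t) [0..<n])))) = mset (map (\<lambda>j. - pos j t) [0..<n])"
      by (simp add: mset_map image_mset.compositionality comp_def)
    show "sorted (rev (map uminus (sort (map (\<lambda>j. pos j t) [0..<n]))))"
      by (rule sorted_rev_uminus) simp
  qed
  then show ?thesis unfolding snapshot_def mirror_def by simp
qed

lemma Pk_rev_uminus:
  assumes "length P = n" "1 \<le> k" "k \<le> n"
  shows "Pk (rev (map uminus P)) k = - Pk P (n + 1 - k)"
  using assms unfolding Pk_def by (simp add: rev_nth)

lemma algo_mirror:
  assumes n_gt_5f: "5*f < n" and len: "length P = n"
  shows "algo n f (rev (map uminus P)) (-x) = - algo n f P x"
proof -
  have a: "Pk (rev (map uminus P)) (f+1) = - Pk P (n-f)" using Pk_rev_uminus[OF len, of "f+1"] n_gt_5f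
    by (simp add: Suc_diff_le)
  have b: "Pk (rev (map uminus P)) (n-f) = - Pk P (f+1)" using Pk_rev_uminus[OF len, of "n-f"] n_gt_5f
    by (simp add: Suc_diff_le)
  have c: "Pk (rev (map uminus P)) (2*f+1) = - Pk P (n-2*f)" using Pk_rev_uminus[OF len, of "2*f+1"] n_gt_5f
    by (simp add: Suc_diff_le)
  have d: "Pk (rev (map uminus P)) (n-2*f) = - Pk P (2*f+1)" using Pk_rev_uminus[OF len, of "n-2*f"] n_gt_5f
    by (simp add: Suc_diff_le)
  have m1: "min (-x) (- Pk P (n-2*f)) = - max x (Pk P (n-2*f))" by (simp add: min_def max_def)
  have m2: "max (-x) (- Pk P (2*f+1)) = - min x (Pk P (2*f+1))" by (simp add: min_def max_def)
  have cnd: "(- x \<le> - Pk P (n - f) \<or> - Pk P (f + 1) \<le> - x) = (x \<le> Pk P (f + 1) \<or> Pk P (n - f) \<le> x)"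
    by auto
  show ?thesis unfolding algo_def a b c d m1 m2 cnd
    by (simp add: field_simps)
qed

lemma cdest_mirror:
  assumes n_gt_5f: "5*f < n"
  shows "cdest n f (mirror pos) look i k = - cdest n f pos look i k"
  unfolding cdest_def snapshot_mirror using algo_mirror[OF n_gt_5f] length_snapshot
  by (simp add: mirror_def)

lemma dest_at_mirror:
  assumes n_gt_5f: "5*f < n"
  shows "dest_at n f (mirror pos) look cmp i t = - dest_at n f pos look cmp i t"
  unfolding dest_at_def using cdest_mirror[OF n_gt_5f] by (simp add: mirror_def)

lemma corda_exec_mirror:
  assumes n_gt_5f: "5 * f < n" and run: "corda_exec n f B \<delta> pos look cmp mend"
  shows "corda_exec n f B \<delta> (mirror pos) look cmp mend"
proof -
  have flip: "(- p = - s + l * (- d - - s)) \<longleftrightarrow> (p = s + l * (d - s))" for p s l d :: real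
    by (auto simp: algebra_simps)
  have abs_flip: "\<bar>- p - - s\<bar> = \<bar>p - s\<bar>" for p s :: real
    by simp
  show ?thesis
    unfolding corda_exec_def Let_def cdest_mirror[OF n_gt_5f]
    unfolding mirror_def flip abs_flip neg_equal_iff_equal
    using run[unfolded corda_exec_def Let_def] .
qed

locale corda_run =
  fixes n f :: nat and B :: "nat set" and \<delta> :: "nat \<Rightarrow> real"
    and pos :: "nat \<Rightarrow> real \<Rightarrow> real" and look cmp mend :: "nat \<Rightarrow> nat \<Rightarrow> real"
  assumes n_gt_5f: "5 * f < n" and B_sub: "B \<subseteq> {..<n}" and card_B: "card B \<le> f"
    and run: "corda_exec n f B \<delta> pos look cmp mend"
begin

abbreviation "correct \<equiv> {..<n} - B"

abbreviation cyc_dest where "cyc_dest i k \<equiv> cdest n f pos look i k"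

lemma finite_correct: "finite correct" by simp

lemma card_correct: "card correct = n - card B"
  using B_sub by (simp add: card_Diff_subset finite_subset)

lemma card_correct_gt_4f: "4 * f < card correct"
  using card_correct card_B n_gt_5f by linarith

lemma correct_nonempty: "correct \<noteq> {}"
  using card_correct_gt_4f by (metis card.empty not_less_zero)

lemmas run_at = bspec[OF run[unfolded corda_exec_def Let_def]]

lemma delta_pos: "i \<in> correct \<Longrightarrow> 0 < \<delta> i"
  using run_at by blast

lemma look_0_nonneg: "i \<in> correct \<Longrightarrow> 0 \<le> look i 0"
  using run_at by blast

lemma look_le_cmp: "i \<in> correct \<Longrightarrow> look i k \<le> cmp i k"
  using run_at by blast

lemma cmp_le_mend: "i \<in> correct \<Longrightarrow> cmp i k \<le> mend i k"
  using run_at by blast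

lemma mend_le_look_Suc: "i \<in> correct \<Longrightarrow> mend i k \<le> look i (Suc k)"
  using run_at by blast

lemma look_unbounded: "i \<in> correct \<Longrightarrow> \<exists>k. T < look i k"
  using run_at by blast

lemma pos_before_first_cmp: "i \<in> correct \<Longrightarrow> 0 \<le> t \<Longrightarrow> t \<le> cmp i 0 \<Longrightarrow> pos i t = pos i 0"
  using run_at by blast

lemma pos_between_moves:
  "i \<in> correct \<Longrightarrow> mend i k \<le> t \<Longrightarrow> t \<le> cmp i (Suc k) \<Longrightarrow> pos i t = pos i (mend i k)"
  using run_at by blast

lemma move_on_segment: "i \<in> correct \<Longrightarrow> \<exists>lam :: real \<Rightarrow> real. mono_on {cmp i k..mend i k} lam \<and>
    (\<forall>t \<in> {cmp i k..mend i k}. 0 \<le> lam t \<and> lam t \<le> 1 \<and>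
       pos i t = pos i (cmp i k) + lam t * (cyc_dest i k - pos i (cmp i k)))"
  using run_at by blast

lemma move_end: "i \<in> correct \<Longrightarrow>
    pos i (mend i k) = cyc_dest i k \<or> \<delta> i \<le> \<bar>pos i (mend i k) - pos i (cmp i k)\<bar>"
  using run_at by blast

lemma cmp_mono: assumes i: "i \<in> correct" shows "k \<le> k' \<Longrightarrow> cmp i k \<le> cmp i k'"
proof (rule lift_Suc_mono_le[where f = "cmp i"])
  show "cmp i k \<le> cmp i (Suc k)" for k
    using cmp_le_mend[OF i, of k] mend_le_look_Suc[OF i, of k] look_le_cmp[OF i, of "Suc k"] by linarith
qed

lemma look_mono: assumes i: "i \<in> correct" shows "k \<le> k' \<Longrightarrow> look i k \<le> look i k'"
proof (rule lift_Suc_mono_le[where f = "look i"])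
  show "look i k \<le> look i (Suc k)" for k
    using cmp_le_mend[OF i, of k] mend_le_look_Suc[OF i, of k] look_le_cmp[OF i, of k] by linarith
qed

lemma cmp_le_later_look: assumes i: "i \<in> correct" and kk: "k < k'" shows "cmp i k \<le> look i k'"
proof -
  have "look i (Suc k) \<le> look i k'" using look_mono[OF i] kk by simp
  then show ?thesis using cmp_le_mend[OF i, of k] mend_le_look_Suc[OF i, of k] by linarith
qed

lemma cmp_unbounded: assumes i: "i \<in> correct" shows "\<exists>k. T < cmp i k"
proof -
  obtain k where "T < look i k" using look_unbounded[OF i] by blast
  then have "T < cmp i k" using look_le_cmp[OF i, of k] by linarith
  then show ?thesis by blast
qed

definition next_cycle :: "nat \<Rightarrow> real \<Rightarrow> nat" where
  "next_cycle i t = (LEAST k. t < cmp i k)"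

lemma cmp_le_iff_less_next_cycle:
  assumes "i \<in> correct" shows "cmp i k \<le> t \<longleftrightarrow> k < next_cycle i t"
proof
  assume "cmp i k \<le> t"
  show "k < next_cycle i t"
  proof (rule ccontr)
    assume "\<not> k < next_cycle i t"
    then have "cmp i (next_cycle i t) \<le> cmp i k" using cmp_mono[OF assms] by simp
    moreover have "t < cmp i (next_cycle i t)"
      unfolding next_cycle_def using cmp_unbounded[OF assms] by (rule LeastI_ex)
    ultimately show False using \<open>cmp i k \<le> t\<close> by simp
  qed
next
  assume "k < next_cycle i t"
  then show "cmp i k \<le> t" unfolding next_cycle_def using not_less_Least by force
qed

lemma less_cmp_next_cycle: assumes i: "i \<in> correct" shows "t < cmp i (next_cycle i t)"
proof (rule ccontr)
  assume "\<not> t < cmp i (next_cycle i t)"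
  then have "cmp i (next_cycle i t) \<le> t" by simp
  then show False using cmp_le_iff_less_next_cycle[OF i] by simp
qed

lemma next_cycle_mono:
  assumes i: "i \<in> correct" and tt: "t \<le> t'" shows "next_cycle i t \<le> next_cycle i t'"
proof (rule ccontr)
  assume "\<not> next_cycle i t \<le> next_cycle i t'"
  then have "next_cycle i t' < next_cycle i t" by simp
  then have "cmp i (next_cycle i t') \<le> t" using cmp_le_iff_less_next_cycle[OF i] by simp
  moreover have "t' < cmp i (next_cycle i t')" by (rule less_cmp_next_cycle[OF i])
  ultimately show False using tt by simp
qed

lemma dest_at_next_cycle:
  assumes "i \<in> correct"
  shows "dest_at n f pos look cmp i t = (if next_cycle i t = 0 then pos i t else cyc_dest i (next_cycle i t - 1))"
proof (cases "next_cycle i t = 0")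
  case True
  then have "\<not> (\<exists>k. cmp i k \<le> t)" using cmp_le_iff_less_next_cycle[OF assms] by simp
  then show ?thesis using True unfolding dest_at_def by simp
next
  case False
  then have e: "cmp i 0 \<le> t" using cmp_le_iff_less_next_cycle[OF assms] by simp
  have "(GREATEST k. cmp i k \<le> t) = next_cycle i t - 1"
  proof (rule Greatest_equality)
    show "cmp i (next_cycle i t - 1) \<le> t" using cmp_le_iff_less_next_cycle[OF assms] False by simp
    show "\<And>y. cmp i y \<le> t \<Longrightarrow> y \<le> next_cycle i t - 1" using cmp_le_iff_less_next_cycle[OF assms] by fastforce
  qed
  then show ?thesis using False e unfolding dest_at_def by auto
qed

lemma common_cycle_after:
  assumes S: "S \<subseteq> correct"
  obtains T' k where "T \<le> T'" "\<And>i. i \<in> S \<Longrightarrow> T < look i (k i)" "\<And>i. i \<in> S \<Longrightarrow> cmp i (k i) \<le> T'"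
proof -
  define k where "k i = (SOME k. T < look i k)" for i
  define T' where "T' = Max (insert T ((\<lambda>i. cmp i (k i)) ` S))"
  have fin: "finite S" using S finite_subset by blast
  have "T \<le> T'" unfolding T'_def using fin by (intro Max_ge) auto
  moreover have "cmp i (k i) \<le> T'" if "i \<in> S" for i
    unfolding T'_def using fin that by (intro Max_ge) auto
  moreover have "T < look i (k i)" if "i \<in> S" for i
  proof -
    have "\<exists>k. T < look i k" using look_unbounded S that by blast
    then show ?thesis unfolding k_def by (rule someI_ex)
  qed
  ultimately show ?thesis using that by blast
qed

lemma pos_cmp_eq_pos_look: "i \<in> correct \<Longrightarrow> pos i (cmp i k) = pos i (look i k)"
proof (cases k)
  case 0
  assume i: "i \<in> correct"
  have "0 \<le> cmp i 0" using look_0_nonneg[OF i] look_le_cmp[OF i, of 0] by linarith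
  then have "pos i (cmp i 0) = pos i 0" using pos_before_first_cmp[OF i, of "cmp i 0"] by simp
  moreover have "pos i (look i 0) = pos i 0" using pos_before_first_cmp[OF i, of "look i 0"] look_0_nonneg[OF i] look_le_cmp[OF i, of 0] by simp
  ultimately show ?thesis using 0 by simp
next
  case (Suc k')
  assume i: "i \<in> correct"
  have a: "mend i k' \<le> look i k" "look i k \<le> cmp i k" using Suc mend_le_look_Suc[OF i, of k'] look_le_cmp[OF i, of k] by auto
  have "pos i (cmp i k) = pos i (mend i k')" using pos_between_moves[OF i, of k' "cmp i k"] a Suc by simp
  moreover have "pos i (look i k) = pos i (mend i k')" using pos_between_moves[OF i, of k' "look i k"] a Suc by simp
  ultimately show ?thesis by simp
qed

lemma pos_between_on_cycle:
  assumes i: "i \<in> correct" and h: "cmp i k \<le> t" "t \<le> t'" "t' \<le> cmp i (Suc k)"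
  shows "min (pos i t) (cyc_dest i k) \<le> pos i t' \<and> pos i t' \<le> max (pos i t) (cyc_dest i k)"
proof -
  obtain lam :: "real \<Rightarrow> real" where mo: "mono_on {cmp i k..mend i k} lam"
    and lp: "\<forall>t \<in> {cmp i k..mend i k}. 0 \<le> lam t \<and> lam t \<le> 1 \<and>
                pos i t = pos i (cmp i k) + lam t * (cyc_dest i k - pos i (cmp i k))"
    using move_on_segment[OF i] by blast
  define s where "s = pos i (cmp i k)"
  define L where "L = (\<lambda>\<tau>. lam (min \<tau> (mend i k)))"
  have cmk: "cmp i k \<le> mend i k" using cmp_le_mend[OF i] .
  have rep: "0 \<le> L \<tau> \<and> L \<tau> \<le> 1 \<and> pos i \<tau> = s + L \<tau> * (cyc_dest i k - s)"
    if "cmp i k \<le> \<tau>" "\<tau> \<le> cmp i (Suc k)" for \<tau>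
  proof (cases "\<tau> \<le> mend i k")
    case True
    then have "\<tau> \<in> {cmp i k..mend i k}" using that by simp
    then have "0 \<le> lam \<tau> \<and> lam \<tau> \<le> 1 \<and> pos i \<tau> = s + lam \<tau> * (cyc_dest i k - s)"
      using lp unfolding s_def by blast
    moreover have "L \<tau> = lam \<tau>" unfolding L_def using True by simp
    ultimately show ?thesis by simp
  next
    case False
    then have e: "pos i \<tau> = pos i (mend i k)" using pos_between_moves[OF i, of k \<tau>] that by simp
    have "mend i k \<in> {cmp i k..mend i k}" using cmk by simp
    then have "0 \<le> lam (mend i k) \<and> lam (mend i k) \<le> 1 \<and> pos i (mend i k) = s + lam (mend i k) * (cyc_dest i k - s)"
      using lp unfolding s_def by blast
    moreover have "L \<tau> = lam (mend i k)" unfolding L_def using False by simp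
    ultimately show ?thesis using e by simp
  qed
  have m1: "min t (mend i k) \<in> {cmp i k..mend i k}" using h cmk by simp
  have m2: "min t' (mend i k) \<in> {cmp i k..mend i k}" using h cmk by simp
  have "min t (mend i k) \<le> min t' (mend i k)" using h by simp
  then have "L t \<le> L t'" unfolding L_def using mono_onD[OF mo m1 m2] by simp
  moreover have r1: "0 \<le> L t \<and> L t \<le> 1 \<and> pos i t = s + L t * (cyc_dest i k - s)" using rep h by simp
  moreover have r2: "0 \<le> L t' \<and> L t' \<le> 1 \<and> pos i t' = s + L t' * (cyc_dest i k - s)" using rep h by simp
  ultimately show ?thesis using affine_point_between[of "L t" "L t'" s "cyc_dest i k"] by simp
qed

lemma pos_eq_first_look: assumes i: "i \<in> correct" and "0 \<le> t" "t \<le> cmp i 0" shows "pos i t = pos i (look i 0)"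
  using pos_before_first_cmp[OF i, of t] pos_before_first_cmp[OF i, of "look i 0"] look_0_nonneg[OF i] look_le_cmp[OF i, of 0] assms by simp

lemma pos_eq_pending_look:
  assumes i: "i \<in> correct" and t: "0 \<le> t" and l: "look i (next_cycle i t) \<le> t"
  shows "pos i t = pos i (look i (next_cycle i t))"
proof -
  have lt: "t < cmp i (next_cycle i t)" using less_cmp_next_cycle[OF i] .
  show ?thesis
  proof (cases "next_cycle i t")
    case 0
    then show ?thesis using pos_eq_first_look[OF i t] lt by simp
  next
    case (Suc K)
    have "pos i t = pos i (mend i K)" using pos_between_moves[OF i, of K t] mend_le_look_Suc[OF i, of K] l lt Suc by auto
    moreover have "pos i (look i (next_cycle i t)) = pos i (mend i K)"
      using pos_between_moves[OF i, of K "look i (Suc K)"] mend_le_look_Suc[OF i, of K] look_le_cmp[OF i] Suc by auto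
    ultimately show ?thesis by simp
  qed
qed

lemma pos_between_last_look_dest:
  assumes i: "i \<in> correct" and K: "next_cycle i t = Suc K"
  shows "min (pos i (look i K)) (cyc_dest i K) \<le> pos i t \<and> pos i t \<le> max (pos i (look i K)) (cyc_dest i K)"
proof -
  have "cmp i K \<le> t" using cmp_le_iff_less_next_cycle[OF i] K by simp
  moreover have "t \<le> cmp i (Suc K)" using less_cmp_next_cycle[OF i, of t] K by simp
  ultimately show ?thesis using pos_between_on_cycle[OF i, of K "cmp i K" t] pos_cmp_eq_pos_look[OF i] by simp
qed

lemma next_look_between:
  assumes i: "i \<in> correct"
  shows "min (pos i (look i k)) (cyc_dest i k) \<le> pos i (look i (Suc k)) \<and>
         pos i (look i (Suc k)) \<le> max (pos i (look i k)) (cyc_dest i k)"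
  using pos_between_on_cycle[OF i, of k "cmp i k" "cmp i (Suc k)"] cmp_mono[OF i, of k "Suc k"] pos_cmp_eq_pos_look[OF i] by simp

lemma next_look_progress:
  assumes i: "i \<in> correct" and up: "pos i (look i k) \<le> cyc_dest i k"
  shows "min (cyc_dest i k) (pos i (look i k) + \<delta> i) \<le> pos i (look i (Suc k))"
proof -
  have sp: "min (pos i (cmp i k)) (cyc_dest i k) \<le> pos i (mend i k) \<and> pos i (mend i k) \<le> max (pos i (cmp i k)) (cyc_dest i k)"
  proof -
    have "mend i k \<le> cmp i (Suc k)" using mend_le_look_Suc[OF i, of k] look_le_cmp[OF i, of "Suc k"] by linarith
    then show ?thesis using pos_between_on_cycle[OF i, of k "cmp i k" "mend i k"] cmp_le_mend[OF i, of k] by simp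
  qed
  have e: "pos i (look i (Suc k)) = pos i (mend i k)"
    using pos_between_moves[OF i, of k "look i (Suc k)"] mend_le_look_Suc[OF i] look_le_cmp[OF i] by simp
  have "pos i (mend i k) = cyc_dest i k \<or> \<bar>pos i (mend i k) - pos i (cmp i k)\<bar> \<ge> \<delta> i" using move_end[OF i] .
  then show ?thesis using sp e up pos_cmp_eq_pos_look[OF i, of k] by auto
qed

text \<open>The destination robot i will compute from a Look it has already taken (its position if there is
  no such Look); low i t is the lowest point the robot can reach before its next Look.\<close>

definition pending_dest :: "nat \<Rightarrow> real \<Rightarrow> real" where
  "pending_dest i t = (if look i (next_cycle i t) \<le> t then cyc_dest i (next_cycle i t) else pos i t)"

definition low :: "nat \<Rightarrow> real \<Rightarrow> real" where
  "low i t = min (pos i t) (min (dest_at n f pos look cmp i t) (pending_dest i t))"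

lemma le_low_iff: "v \<le> low i t \<longleftrightarrow> v \<le> pos i t \<and> v \<le> dest_at n f pos look cmp i t \<and> v \<le> pending_dest i t"
  unfolding low_def by simp

lemma low_le_pos: "low i t \<le> pos i t" unfolding low_def by simp
lemma low_le_dest_at: "low i t \<le> dest_at n f pos look cmp i t" unfolding low_def by simp

lemma low_le_current_cycle:
  assumes i: "i \<in> correct" and t: "0 \<le> t" and v: "v \<le> low i t"
  shows "v \<le> pos i (look i (next_cycle i t)) \<and> (look i (next_cycle i t) \<le> t \<longrightarrow> v \<le> cyc_dest i (next_cycle i t))"
proof (cases "look i (next_cycle i t) \<le> t")
  case True
  then show ?thesis using pos_eq_pending_look[OF i t True] v unfolding le_low_iff pending_dest_def by simp
next
  case False
  have lt: "t < cmp i (next_cycle i t)" using less_cmp_next_cycle[OF i] .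
  show ?thesis
  proof (cases "next_cycle i t")
    case 0
    then have "pos i t = pos i (look i 0)" using pos_eq_first_look[OF i t] lt by simp
    then show ?thesis using v False 0 low_le_pos[of i t] by simp
  next
    case (Suc K)
    have a: "cmp i K \<le> t" using cmp_le_iff_less_next_cycle[OF i] Suc by simp
    have b: "look i (next_cycle i t) \<le> cmp i (Suc K)" using look_le_cmp[OF i] Suc by simp
    have "min (pos i t) (cyc_dest i K) \<le> pos i (look i (next_cycle i t))"
      using pos_between_on_cycle[OF i a, of "look i (next_cycle i t)"] False b Suc by simp
    moreover have "dest_at n f pos look cmp i t = cyc_dest i K" using dest_at_next_cycle[OF i] Suc by simp
    ultimately show ?thesis using v False unfolding le_low_iff by (auto simp: min_le_iff_disj)
  qed
qed

lemma cycle_lower_bound_induct: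
  assumes i: "i \<in> correct" and x0: "v \<le> pos i (look i k0)"
    and st: "\<And>k. k0 \<le> k \<Longrightarrow> v \<le> pos i (look i k) \<Longrightarrow> v \<le> cyc_dest i k"
  shows "k0 \<le> k \<Longrightarrow> v \<le> pos i (look i k) \<and> v \<le> cyc_dest i k"
proof (induction k rule: dec_induct)
  case base then show ?case using x0 st by simp
next
  case (step k)
  then have "v \<le> pos i (look i (Suc k))" using next_look_between[OF i, of k] by (auto simp: min_le_iff_disj)
  then show ?case using st step by simp
qed

lemma pos_same_cycle:
  assumes i: "i \<in> correct" and T: "0 \<le> T" and tT: "T \<le> t"
    and same: "next_cycle i t = next_cycle i T"
  shows "min (pos i T) (dest_at n f pos look cmp i T) \<le> pos i t"
proof (cases "next_cycle i t")
  case 0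
  then have "t \<le> cmp i 0" using less_cmp_next_cycle[OF i, of t] by simp
  then have "pos i t = pos i T"
    using pos_before_first_cmp[OF i, of t] pos_before_first_cmp[OF i, of T] T tT by simp
  then show ?thesis by simp
next
  case (Suc K)
  then have K: "next_cycle i T = Suc K" using same by simp
  have "cmp i K \<le> T" using cmp_le_iff_less_next_cycle[OF i] K by simp
  moreover have "t \<le> cmp i (Suc K)" using less_cmp_next_cycle[OF i, of t] Suc by simp
  ultimately have "min (pos i T) (cyc_dest i K) \<le> pos i t"
    using pos_between_on_cycle[OF i _ tT] by simp
  moreover have "dest_at n f pos look cmp i T = cyc_dest i K"
    using dest_at_next_cycle[OF i, of T] K by simp
  ultimately show ?thesis by simp
qed

lemma low_lower_bound_from:
  assumes i: "i \<in> correct" and T: "0 \<le> T" and lv: "v \<le> low i T"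
    and cy: "\<And>k. next_cycle i T \<le> k \<Longrightarrow> v \<le> pos i (look i k) \<and> v \<le> cyc_dest i k" and tT: "T \<le> t"
  shows "v \<le> low i t"
proof -
  have KK: "next_cycle i T \<le> next_cycle i t" using next_cycle_mono[OF i tT] .
  have po: "v \<le> pos i t"
  proof (cases "next_cycle i t = next_cycle i T")
    case True
    then show ?thesis
      using pos_same_cycle[OF i T tT] lv unfolding le_low_iff by (auto simp: min_le_iff_disj)
  next
    case False
    then obtain K where K: "next_cycle i t = Suc K" "next_cycle i T \<le> K"
      using KK by (cases "next_cycle i t") auto
    then show ?thesis
      using pos_between_last_look_dest[OF i K(1)] cy[OF K(2)] by (auto simp: min_le_iff_disj)
  qed
  have de: "v \<le> dest_at n f pos look cmp i t"
  proof (cases "next_cycle i t")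
    case 0
    then show ?thesis using po dest_at_next_cycle[OF i] by simp
  next
    case (Suc K)
    show ?thesis
    proof (cases "next_cycle i T \<le> K")
      case True
      then show ?thesis using Suc cy[of K] dest_at_next_cycle[OF i] by simp
    next
      case False
      then have "next_cycle i T = Suc K" using KK Suc by simp
      then show ?thesis
        using lv Suc dest_at_next_cycle[OF i, of T] dest_at_next_cycle[OF i, of t]
        unfolding le_low_iff by simp
    qed
  qed
  have pe: "v \<le> pending_dest i t"
    unfolding pending_dest_def using po cy KK by simp
  show ?thesis using po de pe unfolding le_low_iff by simp
qed

lemma low_lower_bound_after:
  assumes i: "i \<in> correct" and cy: "\<And>k. k0 \<le> k \<Longrightarrow> v \<le> pos i (look i k) \<and> v \<le> cyc_dest i k"
    and t: "cmp i k0 \<le> t"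
  shows "v \<le> low i t"
proof -
  have K: "k0 < next_cycle i t" using cmp_le_iff_less_next_cycle[OF i] t by simp
  then obtain K where KS: "next_cycle i t = Suc K" and kK: "k0 \<le> K" by (cases "next_cycle i t") auto
  have po: "v \<le> pos i t" using pos_between_last_look_dest[OF i KS] cy[OF kK] by (auto simp: min_le_iff_disj)
  have de: "v \<le> dest_at n f pos look cmp i t" using dest_at_next_cycle[OF i] KS cy[OF kK] by simp
  have pe: "v \<le> pending_dest i t" unfolding pending_dest_def using po cy[of "next_cycle i t"] K by simp
  show ?thesis using po de pe unfolding le_low_iff by simp
qed

lemma pos_lower_bound:
  assumes i: "i \<in> correct" and T: "0 \<le> T" and lv: "v \<le> low i T" and tT: "T < t"
    and good: "\<And>k. next_cycle i T \<le> k \<Longrightarrow> look i k < t \<Longrightarrow> v \<le> cyc_dest i k"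
  shows "v \<le> pos i t"
proof -
  let ?K0 = "next_cycle i T"
  have x0: "v \<le> pos i (look i ?K0)" using low_le_current_cycle[OF i T lv] by simp
  have Q: "v \<le> pos i (look i k)" if "?K0 \<le> k" "look i k \<le> t" for k
    using that
  proof (induction k rule: dec_induct)
    case base then show ?case using x0 by simp
  next
    case (step k)
    have lk: "look i k \<le> t" using look_mono[OF i, of k "Suc k"] step.prems by simp
    then have IH: "v \<le> pos i (look i k)" using step.IH by simp
    show ?case
    proof (cases "look i k < t")
      case True
      then have "v \<le> cyc_dest i k" using good step.hyps by simp
      then show ?thesis using next_look_between[OF i, of k] IH by (auto simp: min_le_iff_disj)
    next
      case False
      then have "look i k = t" using lk by simp
      moreover have "look i k \<le> look i (Suc k)" using look_mono[OF i] by simp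
      ultimately have "look i (Suc k) = look i k" using step.prems by simp
      then show ?thesis using IH by simp
    qed
  qed
  have KK: "?K0 \<le> next_cycle i t" using next_cycle_mono[OF i] tT by simp
  show ?thesis
  proof (cases "next_cycle i t = ?K0")
    case True
    then show ?thesis
      using pos_same_cycle[OF i T less_imp_le[OF tT]] lv unfolding le_low_iff
      by (auto simp: min_le_iff_disj)
  next
    case False
    then obtain K where K: "next_cycle i t = Suc K" "?K0 \<le> K"
      using KK by (cases "next_cycle i t") auto
    have ck: "cmp i K \<le> t" using cmp_le_iff_less_next_cycle[OF i] K(1) by simp
    then have lkt: "look i K \<le> t" using look_le_cmp[OF i, of K] by simp
    show ?thesis
    proof (cases "look i K < t")
      case True
      then have "v \<le> cyc_dest i K" using good K(2) by simp
      then show ?thesis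
        using pos_between_last_look_dest[OF i K(1)] Q[OF K(2) lkt] by (auto simp: min_le_iff_disj)
    next
      case False
      then have "cmp i K = t" using look_le_cmp[OF i, of K] ck lkt by simp
      then show ?thesis using pos_cmp_eq_pos_look[OF i, of K] Q[OF K(2) lkt] by simp
    qed
  qed
qed

lemma look_nonneg: "i \<in> correct \<Longrightarrow> 0 \<le> look i k"
  using look_0_nonneg look_mono by (meson le0 order_trans)

lemma cmp_nonneg: "i \<in> correct \<Longrightarrow> 0 \<le> cmp i k"
  using look_nonneg look_le_cmp by (meson order_trans)

lemma cyc_dest_eq: "cyc_dest i k = algo n f (snapshot n pos (look i k)) (pos i (look i k))"
  by (simp add: cdest_def)

lemma finite_looks_before: assumes i: "i \<in> correct" shows "finite {k. look i k \<le> L}"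
proof -
  obtain k' where k': "L < look i k'" using look_unbounded[OF i] by blast
  have "{k. look i k \<le> L} \<subseteq> {..<k'}"
  proof
    fix k assume "k \<in> {k. look i k \<le> L}"
    then have "look i k \<le> L" by simp
    then show "k \<in> {..<k'}" using look_mono[OF i, of k' k] k' by (cases "k' \<le> k") auto
  qed
  then show ?thesis by (rule finite_subset) simp
qed

lemma earliest_look:
  assumes S: "S \<subseteq> correct" and i1: "i1 \<in> S" "V i1 k1"
  obtains i k where "i \<in> S" "V i k" "\<And>j k'. j \<in> S \<Longrightarrow> V j k' \<Longrightarrow> look i k \<le> look j k'"
proof -
  define A where "A = {(i, k). i \<in> S \<and> V i k \<and> look i k \<le> look i1 k1}"
  define g where "g p = look (fst p) (snd p)" for p
  have "A \<subseteq> Sigma S (\<lambda>i. {k. look i k \<le> look i1 k1})" unfolding A_def by auto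
  moreover have "finite (Sigma S (\<lambda>i. {k. look i k \<le> look i1 k1}))"
    using S finite_subset[OF S finite_correct] finite_looks_before by (intro finite_SigmaI) auto
  ultimately have "finite A" by (rule finite_subset)
  then have fin: "finite (g ` A)" by simp
  have "(i1, k1) \<in> A" unfolding A_def using i1 by simp
  then have "Min (g ` A) \<in> g ` A" using fin by (intro Min_in) auto
  then obtain p where p: "p \<in> A" "g p = Min (g ` A)" by auto
  obtain i k where ik: "p = (i, k)" by (cases p)
  have min: "look i k \<le> look j k'" if "j \<in> S" "V j k'" for j k'
  proof (cases "look j k' \<le> look i1 k1")
    case True
    then have "(j, k') \<in> A" unfolding A_def using that by simp
    then have "Min (g ` A) \<le> g (j, k')" using fin by simp
    then show ?thesis using p ik unfolding g_def by simp
  next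
    case False
    then show ?thesis using p(1) ik unfolding A_def by simp
  qed
  have "i \<in> S" "V i k" using p(1) ik unfolding A_def by auto
  then show ?thesis using min by (rule that)
qed

lemma cyc_dest_lower_bound_invariant:
  assumes S: "S \<subseteq> correct" and T: "0 \<le> T" and st: "\<And>j. j \<in> S \<Longrightarrow> \<theta> j \<le> low j T"
    and step: "\<And>i k. i \<in> S \<Longrightarrow> T < look i k \<Longrightarrow> (\<And>j. j \<in> S \<Longrightarrow> \<theta> j \<le> pos j (look i k)) \<Longrightarrow> \<theta> i \<le> cyc_dest i k"
    and i: "i \<in> S" and k: "next_cycle i T \<le> k"
  shows "\<theta> i \<le> cyc_dest i k"
proof (rule ccontr)
  assume "\<not> \<theta> i \<le> cyc_dest i k"
  then have viol: "next_cycle i T \<le> k \<and> cyc_dest i k < \<theta> i" using k by simp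
  show False
  proof (rule earliest_look[where V = "\<lambda>i k. next_cycle i T \<le> k \<and> cyc_dest i k < \<theta> i", OF S i viol])
    fix i k assume iS: "i \<in> S" and ik: "next_cycle i T \<le> k \<and> cyc_dest i k < \<theta> i"
      and first: "\<And>j k'. j \<in> S \<Longrightarrow> next_cycle j T \<le> k' \<and> cyc_dest j k' < \<theta> j \<Longrightarrow> look i k \<le> look j k'"
    have iC: "i \<in> correct" using iS S by auto
    show False
    proof (cases "look i k \<le> T")
      case True
      have "k = next_cycle i T"
      proof (rule ccontr)
        assume "k \<noteq> next_cycle i T"
        then have "cmp i (next_cycle i T) \<le> look i k" using cmp_le_later_look[OF iC] ik by simp
        then show False using less_cmp_next_cycle[OF iC, of T] True by simp
      qed
      then show False using low_le_current_cycle[OF iC T st[OF iS]] True ik by simp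
    next
      case False
      have "\<theta> j \<le> pos j (look i k)" if j: "j \<in> S" for j
      proof (rule pos_lower_bound[OF _ T st[OF j]])
        show "j \<in> correct" using j S by auto
        show "T < look i k" using False by simp
        show "\<theta> j \<le> cyc_dest j k'" if "next_cycle j T \<le> k'" "look j k' < look i k" for k'
          using first[OF j] that by force
      qed
      then have "\<theta> i \<le> cyc_dest i k" using step[OF iS] False by simp
      then show False using ik by simp
    qed
  qed
qed

lemma lower_bound_invariant:
  assumes S: "S \<subseteq> correct" and T: "0 \<le> T" and st: "\<And>j. j \<in> S \<Longrightarrow> \<theta> j \<le> low j T"
    and step: "\<And>i k. i \<in> S \<Longrightarrow> T < look i k \<Longrightarrow> (\<And>j. j \<in> S \<Longrightarrow> \<theta> j \<le> pos j (look i k)) \<Longrightarrow> \<theta> i \<le> cyc_dest i k"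
    and iS: "i \<in> S" and tT: "T \<le> t"
  shows "\<theta> i \<le> low i t"
proof -
  have iC: "i \<in> correct" using iS S by auto
  have "\<theta> i \<le> pos i (look i k) \<and> \<theta> i \<le> cyc_dest i k" if "next_cycle i T \<le> k" for k
  proof (rule cycle_lower_bound_induct[OF iC _ _ that])
    show "\<theta> i \<le> pos i (look i (next_cycle i T))" using low_le_current_cycle[OF iC T st[OF iS]] by simp
    show "\<theta> i \<le> cyc_dest i k'" if "next_cycle i T \<le> k'" for k'
      by (rule cyc_dest_lower_bound_invariant[OF S T st step iS that])
  qed
  then show ?thesis by (rule low_lower_bound_from[OF iC T st[OF iS] _ tT])
qed

lemma pos_frozen:
  assumes i: "i \<in> correct" and fr: "\<And>k. k1 \<le> k \<Longrightarrow> cyc_dest i k = pos i (look i k)" and t: "cmp i k1 \<le> t"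
  shows "pos i t = pos i (look i k1) \<and> low i t = pos i (look i k1)"
proof -
  have xs: "pos i (look i k) = pos i (look i k1)" if "k1 \<le> k" for k
    using that
  proof (induction k rule: dec_induct)
    case base then show ?case by simp
  next
    case (step k)
    then have "cyc_dest i k = pos i (look i k)" using fr by simp
    then have "pos i (look i (Suc k)) = pos i (look i k)" using next_look_between[OF i, of k] by simp
    then show ?case using step by simp
  qed
  have K: "k1 < next_cycle i t" using cmp_le_iff_less_next_cycle[OF i] t by simp
  then obtain K where KS: "next_cycle i t = Suc K" and kK: "k1 \<le> K" by (cases "next_cycle i t") auto
  have dK: "cyc_dest i K = pos i (look i k1)" using fr[OF kK] xs[OF kK] by simp
  have po: "pos i t = pos i (look i k1)" using pos_between_last_look_dest[OF i KS] dK xs[OF kK] by simp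
  have de: "dest_at n f pos look cmp i t = pos i (look i k1)" using dest_at_next_cycle[OF i] KS dK by simp
  have pe: "pending_dest i t = pos i (look i k1)" unfolding pending_dest_def using po fr[of "next_cycle i t"] xs[of "next_cycle i t"] K by simp
  show ?thesis using po de pe unfolding low_def by simp
qed

lemma low_eq_pos_if_ascending:
  assumes i: "i \<in> correct" and up: "\<And>k. k1 \<le> k \<Longrightarrow> pos i (look i k) \<le> cyc_dest i k" and t: "cmp i k1 \<le> t"
  shows "low i t = pos i t"
proof -
  have t0: "0 \<le> t" using cmp_nonneg[OF i, of k1] t by simp
  have K: "k1 < next_cycle i t" using cmp_le_iff_less_next_cycle[OF i] t by simp
  then obtain K where KS: "next_cycle i t = Suc K" and kK: "k1 \<le> K" by (cases "next_cycle i t") auto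
  have "pos i t \<le> cyc_dest i K" using pos_between_last_look_dest[OF i KS] up[OF kK] by (auto simp: le_max_iff_disj)
  then have de: "pos i t \<le> dest_at n f pos look cmp i t" using dest_at_next_cycle[OF i] KS by simp
  have pe: "pos i t \<le> pending_dest i t"
  proof (cases "look i (next_cycle i t) \<le> t")
    case True
    then have "pos i t = pos i (look i (next_cycle i t))" using pos_eq_pending_look[OF i t0] by simp
    then show ?thesis unfolding pending_dest_def using True up[of "next_cycle i t"] K by simp
  next
    case False then show ?thesis unfolding pending_dest_def by simp
  qed
  show ?thesis using de pe unfolding low_def by simp
qed

lemma card_below_le_f_plus_correct: "card {j. j < n \<and> pos j t < y} \<le> f + card {j \<in> correct. pos j t < y}"
proof -
  have "{j. j < n \<and> pos j t < y} \<subseteq> B \<union> {j \<in> correct. pos j t < y}" by auto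
  then have "card {j. j < n \<and> pos j t < y} \<le> card (B \<union> {j \<in> correct. pos j t < y})"
    using B_sub by (intro card_mono) (auto intro: finite_subset)
  also have "\<dots> \<le> card B + card {j \<in> correct. pos j t < y}" by (rule card_Un_le)
  finally show ?thesis using card_B by simp
qed

lemma card_correct_below_le: "card {j \<in> correct. pos j t < y} \<le> card {j. j < n \<and> pos j t < y}"
  by (rule card_mono) auto

lemma card_correct_above_le: "card {j \<in> correct. x < pos j t} \<le> n - card {j. j < n \<and> pos j t \<le> x}"
proof -
  have d: "{j. j < n \<and> pos j t \<le> x} \<inter> {j \<in> correct. x < pos j t} = {}" by auto
  have u: "{j. j < n \<and> pos j t \<le> x} \<union> {j \<in> correct. x < pos j t} \<subseteq> {..<n}" by auto
  have "card {j. j < n \<and> pos j t \<le> x} + card {j \<in> correct. x < pos j t}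
      = card ({j. j < n \<and> pos j t \<le> x} \<union> {j \<in> correct. x < pos j t})"
    using d by (intro card_Un_disjoint[symmetric]) auto
  also have "\<dots> \<le> n" using card_mono[OF _ u] by simp
  finally show ?thesis by simp
qed

lemma card_below_le_f_if_byzantine:
  assumes "\<And>j. j < n \<Longrightarrow> pos j t < x \<Longrightarrow> j \<in> B"
  shows "card {j. j < n \<and> pos j t < x} \<le> f"
proof -
  have "{j. j < n \<and> pos j t < x} \<subseteq> B" using assms by auto
  then have "card {j. j < n \<and> pos j t < x} \<le> card B" using B_sub by (intro card_mono) (auto intro: finite_subset)
  then show ?thesis using card_B by simp
qed

lemma mirror_run: "corda_run n f B \<delta> (mirror pos) look cmp mend"
proof
  show "5 * f < n" by (rule n_gt_5f)
  show "B \<subseteq> {..<n}" by (rule B_sub)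
  show "card B \<le> f" by (rule card_B)
  show "corda_exec n f B \<delta> (mirror pos) look cmp mend" by (rule corda_exec_mirror[OF n_gt_5f run])
qed

definition low_min :: "real \<Rightarrow> real" where
  "low_min t = Min ((\<lambda>i. low i t) ` correct)"

lemma low_min_le: "i \<in> correct \<Longrightarrow> low_min t \<le> low i t"
  unfolding low_min_def by simp

lemma low_min_attained: "\<exists>i\<in>correct. low i t = low_min t"
proof -
  have "low_min t \<in> (\<lambda>i. low i t) ` correct" unfolding low_min_def using correct_nonempty by (intro Min_in) auto
  then show ?thesis by auto
qed

lemma low_min_greatest: "(\<And>i. i \<in> correct \<Longrightarrow> v \<le> low i t) \<Longrightarrow> v \<le> low_min t"
  unfolding low_min_def using correct_nonempty by simp

lemma cyc_dest_ge_min: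
  assumes i: "i \<in> correct" and c: "card {j. j < n \<and> pos j (look i k) < y} \<le> 2*f"
  shows "min (pos i (look i k)) y \<le> cyc_dest i k"
proof -
  have "y \<le> Pk (snapshot n pos (look i k)) (2*f+1)" using Pk_low_trim_ge[of f n pos "look i k" y] n_gt_5f c by simp
  then have "min (pos i (look i k)) y \<le> min (pos i (look i k)) (Pk (snapshot n pos (look i k)) (2*f+1))"
    by (simp add: min_def)
  also have "\<dots> \<le> (pos i (look i k) + min (pos i (look i k)) (Pk (snapshot n pos (look i k)) (2*f+1)))/2"
    by (simp add: min_def)
  also have "\<dots> \<le> cyc_dest i k" unfolding cyc_dest_eq by (rule algo_ge_half_low)
  finally show ?thesis .
qed

lemma low_persists:
  assumes s: "0 \<le> s" and c: "card {j \<in> correct. low j s < y} \<le> f" and st: "s \<le> t" and i: "i \<in> correct"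
  shows "min (low i s) y \<le> low i t"
proof (rule lower_bound_invariant[of correct s "\<lambda>j. min (low j s) y" i t])
  show "correct \<subseteq> correct" by simp
  show "0 \<le> s" by (rule s)
  show "\<And>j. j \<in> correct \<Longrightarrow> min (low j s) y \<le> low j s" by simp
  show "i \<in> correct" by (rule i)
  show "s \<le> t" by (rule st)
  fix i' k assume i': "i' \<in> correct" and "s < look i' k"
    and all: "\<And>j. j \<in> correct \<Longrightarrow> min (low j s) y \<le> pos j (look i' k)"
  have "{j \<in> correct. pos j (look i' k) < y} \<subseteq> {j \<in> correct. low j s < y}"
  proof (intro subsetI)
    fix j assume "j \<in> {j \<in> correct. pos j (look i' k) < y}"
    then have j: "j \<in> correct" "pos j (look i' k) < y" by auto
    then have "min (low j s) y \<le> pos j (look i' k)" using all by simp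
    then show "j \<in> {j \<in> correct. low j s < y}" using j by (auto simp: min_le_iff_disj)
  qed
  then have "card {j \<in> correct. pos j (look i' k) < y} \<le> card {j \<in> correct. low j s < y}"
    by (intro card_mono) auto
  then have "card {j \<in> correct. pos j (look i' k) < y} \<le> f" using c by linarith
  then have "card {j. j < n \<and> pos j (look i' k) < y} \<le> 2*f"
    using card_below_le_f_plus_correct[of "look i' k" y] by simp
  then have "min (pos i' (look i' k)) y \<le> cyc_dest i' k" by (rule cyc_dest_ge_min[OF i'])
  moreover have "min (low i' s) y \<le> pos i' (look i' k)" using all[OF i'] .
  ultimately show "min (low i' s) y \<le> cyc_dest i' k" by (auto simp: min_le_iff_disj)
qed

lemma low_min_mono:
  assumes T: "0 \<le> T" and tT: "T \<le> t" shows "low_min T \<le> low_min t"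
proof (rule low_min_greatest)
  fix i assume i: "i \<in> correct"
  have c: "card {j \<in> correct. low j T < low_min T} \<le> f"
  proof -
    have nl: "\<not> low j T < low_min T" if "j \<in> correct" for j using low_min_le[OF that, of T] by simp
    have e: "{j \<in> correct. low j T < low_min T} = {}" using nl by blast
    show ?thesis unfolding e by simp
  qed
  show "low_min T \<le> low i t" using low_persists[OF T c tT i] low_min_le[OF i, of T] by simp
qed

abbreviation high_max where "high_max t \<equiv> - corda_run.low_min n f B (mirror pos) look cmp t"

lemma pos_le_high_max_0:
  assumes t: "0 \<le> t" and i: "i \<in> correct" shows "pos i t \<le> high_max 0"
proof -
  interpret N: corda_run n f B \<delta> "mirror pos" look cmp mend by (rule mirror_run)
  have "N.low_min 0 \<le> N.low_min t" using N.low_min_mono t by simp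
  also have "\<dots> \<le> N.low i t" using N.low_min_le i by simp
  also have "\<dots> \<le> mirror pos i t" by (rule N.low_le_pos)
  finally show ?thesis by (simp add: mirror_def)
qed

lemma low_min_le_high_max_0: "0 \<le> t \<Longrightarrow> low_min t \<le> high_max 0"
proof -
  assume t: "0 \<le> t"
  obtain i where i: "i \<in> correct" using correct_nonempty by auto
  have "low_min t \<le> low i t" using low_min_le[OF i] .
  also have "\<dots> \<le> pos i t" by (rule low_le_pos)
  also have "\<dots> \<le> high_max 0" using pos_le_high_max_0[OF t i] .
  finally show ?thesis .
qed

definition low_lim :: real where "low_lim = Sup (low_min ` {0..})"
text \<open>Below a robust level at most f correct robots remain low from some time on
  (see eventually_few_low_below).\<close>

definition robust_levels :: "real set" where "robust_levels = {y. \<exists>T\<ge>0. card {i\<in>correct. low i T < y} \<le> f}"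
definition robust_low :: real where "robust_low = Sup robust_levels"

lemma bdd_above_low_min: "bdd_above (low_min ` {0..})"
  using low_min_le_high_max_0 by (intro bdd_aboveI[of _ "high_max 0"]) auto

lemma low_min_le_low_lim: "0 \<le> t \<Longrightarrow> low_min t \<le> low_lim"
  unfolding low_lim_def using bdd_above_low_min by (intro cSup_upper) auto

lemma low_lim_approx: "0 < e \<Longrightarrow> \<exists>T\<ge>0. low_lim - e < low_min T"
proof -
  assume e: "0 < e"
  have "low_lim - e < Sup (low_min ` {0..})" unfolding low_lim_def using e by simp
  then obtain y where "y \<in> low_min ` {0..}" "low_lim - e < y"
    using less_cSup_iff[of "low_min ` {0..}" "low_lim - e"] bdd_above_low_min by auto
  then show ?thesis by auto
qed

lemma eventually_low_min_near_low_lim: "0 < e \<Longrightarrow> \<exists>T\<ge>0. \<forall>t\<ge>T. low_lim - e < low_min t"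
proof -
  assume "0 < e"
  then obtain T where T: "0 \<le> T" "low_lim - e < low_min T" using low_lim_approx by blast
  have "low_lim - e < low_min t" if "T \<le> t" for t using low_min_mono[OF T(1) that] T by simp
  then show ?thesis using T by blast
qed

lemma bdd_above_robust_levels: "bdd_above robust_levels"
proof (rule bdd_aboveI[of _ "high_max 0"])
  fix y assume "y \<in> robust_levels"
  then obtain T where T: "0 \<le> T" "card {i\<in>correct. low i T < y} \<le> f" unfolding robust_levels_def by auto
  have "\<exists>i\<in>correct. \<not> low i T < y"
  proof (rule ccontr)
    assume "\<not> (\<exists>i\<in>correct. \<not> low i T < y)"
    then have "{i\<in>correct. low i T < y} = correct" by auto
    then show False using T card_correct_gt_4f by simp
  qed
  then obtain i where i: "i \<in> correct" "y \<le> low i T" by auto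
  show "y \<le> high_max 0" using i low_le_pos[of i T] pos_le_high_max_0[OF T(1) i(1)] by simp
qed

lemma low_min_in_robust_levels: "0 \<le> T \<Longrightarrow> low_min T \<in> robust_levels"
proof -
  assume T: "0 \<le> T"
  have nl: "\<not> low j T < low_min T" if "j \<in> correct" for j
  proof -
    have "low_min T \<le> low j T" by (rule low_min_le[OF that])
    then show ?thesis by simp
  qed
  have e: "{j \<in> correct. low j T < low_min T} = {}" using nl by blast
  have c: "card {j\<in>correct. low j T < low_min T} \<le> f" unfolding e by simp
  show ?thesis unfolding robust_levels_def mem_Collect_eq using T c by blast
qed

lemma low_lim_le_robust_low: "low_lim \<le> robust_low"
  unfolding low_lim_def robust_low_def
proof (rule cSup_least)
  show "low_min ` {0..} \<noteq> {}" by auto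
  fix x assume "x \<in> low_min ` {0..}"
  then obtain T where "0 \<le> T" "x = low_min T" by auto
  then show "x \<le> Sup robust_levels" using low_min_in_robust_levels bdd_above_robust_levels by (auto intro: cSup_upper)
qed

lemma eventually_few_low_below:
  assumes y: "y < robust_low"
  shows "\<exists>T\<ge>0. \<forall>t\<ge>T. card {i\<in>correct. low i t < y} \<le> f"
proof -
  have ne: "robust_levels \<noteq> {}" using low_min_in_robust_levels[of 0] by auto
  obtain y0 where y0: "y0 \<in> robust_levels" "y < y0"
    using less_cSup_iff[OF ne bdd_above_robust_levels, of y] y unfolding robust_low_def by auto
  obtain T where T: "0 \<le> T" "card {i\<in>correct. low i T < y0} \<le> f" using y0(1) unfolding robust_levels_def by auto
  have "card {i\<in>correct. low i t < y} \<le> f" if tT: "T \<le> t" for t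
  proof -
    have "{i\<in>correct. low i t < y} \<subseteq> {i\<in>correct. low i T < y0}"
    proof (intro subsetI)
      fix i assume "i \<in> {i\<in>correct. low i t < y}"
      then have i: "i \<in> correct" "low i t < y" by auto
      have "min (low i T) y0 \<le> low i t" by (rule low_persists[OF T(1) T(2) tT i(1)])
      then show "i \<in> {i\<in>correct. low i T < y0}" using i y0(2) by (auto simp: min_le_iff_disj)
    qed
    then have "card {i\<in>correct. low i t < y} \<le> card {i\<in>correct. low i T < y0}" by (intro card_mono) auto
    then show ?thesis using T(2) by linarith
  qed
  then show ?thesis using T(1) by blast
qed

lemma many_low_below:
  assumes y: "robust_low < y" and T: "0 \<le> T"
  shows "f < card {i\<in>correct. low i T < y}"
proof (rule ccontr)
  assume "\<not> f < card {i\<in>correct. low i T < y}"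
  then have "y \<in> robust_levels" unfolding robust_levels_def using T by auto
  then have "y \<le> robust_low" unfolding robust_low_def using bdd_above_robust_levels by (rule cSup_upper)
  then show False using y by simp
qed

lemma frozen_group_exposed:
  assumes S: "S \<subseteq> correct" "S \<noteq> {}" and T: "0 \<le> T"
    and fr: "\<And>i k. i \<in> S \<Longrightarrow> T \<le> look i k \<Longrightarrow> cyc_dest i k = pos i (look i k)"
    and sep: "\<And>t i j. T \<le> t \<Longrightarrow> i \<in> S \<Longrightarrow> j \<in> correct \<Longrightarrow> j \<notin> S \<Longrightarrow> low i t < low j t"
  shows "\<exists>i\<in>S. \<exists>k. T \<le> look i k \<and> card {j. j < n \<and> pos j (look i k) < pos i (look i k)} \<le> f"
proof -
  obtain T' k where T': "T \<le> T'" "\<And>i. i \<in> S \<Longrightarrow> T < look i (k i)" "\<And>i. i \<in> S \<Longrightarrow> cmp i (k i) \<le> T'"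
    using common_cycle_after[OF S(1)] by blast
  define p where "p i = pos i (look i (k i))" for i
  have frz: "pos i t = p i \<and> low i t = p i" if i: "i \<in> S" and t: "T' \<le> t" for i t
  proof -
    have iC: "i \<in> correct" using S(1) i by blast
    have "cyc_dest i k' = pos i (look i k')" if "k i \<le> k'" for k'
      using fr[OF i] T'(2)[OF i] look_mono[OF iC that] by simp
    then show ?thesis unfolding p_def using pos_frozen[OF iC _ order_trans[OF T'(3)[OF i] t]] by blast
  qed
  have finS: "finite S" using S finite_subset finite_correct by blast
  then have "Min (p ` S) \<in> p ` S" using S(2) by (intro Min_in) auto
  then obtain i0 where i0: "i0 \<in> S" "p i0 = Min (p ` S)" by auto
  have i0min: "p i0 \<le> p i" if "i \<in> S" for i using i0 finS that by simp
  have i0C: "i0 \<in> correct" using S(1) i0(1) by blast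
  obtain k0 where k0: "T' < look i0 k0" using look_unbounded[OF i0C] by blast
  let ?l = "look i0 k0"
  have lT: "T \<le> ?l" using k0 T'(1) by simp
  have f0: "pos i0 ?l = p i0 \<and> low i0 ?l = p i0" using frz[OF i0(1)] k0 by simp
  have "card {j. j < n \<and> pos j ?l < pos i0 ?l} \<le> f"
  proof (rule card_below_le_f_if_byzantine)
    fix j assume j: "j < n" "pos j ?l < pos i0 ?l"
    show "j \<in> B"
    proof (rule ccontr)
      assume "j \<notin> B"
      then have jC: "j \<in> correct" using j by simp
      show False
      proof (cases "j \<in> S")
        case True
        then have "pos j ?l = p j" using frz[OF True] k0 by simp
        then show False using i0min[OF True] j f0 by simp
      next
        case False
        have "low i0 ?l < low j ?l" using sep[OF lT i0(1) jC False] .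
        then show False using j f0 low_le_pos[of j ?l] by simp
      qed
    qed
  qed
  then show ?thesis using i0(1) lT by blast
qed

lemma delta_lower_bound: "\<exists>dm>0. \<forall>i\<in>correct. dm \<le> \<delta> i"
proof -
  have fin: "finite (\<delta> ` correct)" "\<delta> ` correct \<noteq> {}" using correct_nonempty by auto
  have "0 < Min (\<delta> ` correct)" using fin delta_pos by (auto simp: Min_gr_iff)
  moreover have "\<forall>i\<in>correct. Min (\<delta> ` correct) \<le> \<delta> i" using fin by simp
  ultimately show ?thesis by blast
qed

lemma card_pos_below_le_card_low_below: "card {j\<in>correct. pos j t < y} \<le> card {j\<in>correct. low j t < y}"
proof (rule card_mono)
  show "finite {j\<in>correct. low j t < y}" by simp
  show "{j\<in>correct. pos j t < y} \<subseteq> {j\<in>correct. low j t < y}" using low_le_pos[of _ t] by (auto intro: le_less_trans)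
qed

lemma eventually_few_pos_below:
  assumes y: "y < robust_low"
  shows "\<exists>T\<ge>0. \<forall>t\<ge>T. card {j\<in>correct. pos j t < y} \<le> f"
proof -
  obtain T where T: "0 \<le> T" "\<And>t. T \<le> t \<Longrightarrow> card {i\<in>correct. low i t < y} \<le> f"
    using eventually_few_low_below[OF y] by blast
  have "card {j\<in>correct. pos j t < y} \<le> f" if "T \<le> t" for t
    using card_pos_below_le_card_low_below[of t y] T(2)[OF that] by linarith
  then show ?thesis using T(1) by blast
qed

lemma eventually_bottom_group_stable:
  assumes lt: "low_lim < robust_low"
  shows "\<exists>T\<ge>0. \<exists>S. S \<subseteq> correct \<and> S \<noteq> {} \<and> (\<forall>t\<ge>T. \<forall>i\<in>correct. i \<in> S \<longleftrightarrow> low i t \<le> low_lim)"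
proof -
  define y where "y = (low_lim + robust_low) / 2"
  have y: "low_lim < y" "y < robust_low" unfolding y_def using lt by auto
  obtain T where T: "0 \<le> T" "\<And>t. T \<le> t \<Longrightarrow> card {i\<in>correct. low i t < y} \<le> f"
    using eventually_few_low_below[OF y(2)] by blast
  have "\<exists>T'\<ge>T. \<exists>S. S \<subseteq> correct \<and> 1 \<le> card S \<and> (\<forall>t\<ge>T'. \<forall>i\<in>correct. i \<in> S \<longleftrightarrow> low i t \<le> low_lim)"
  proof (rule shrinking_filter_stabilizes)
    show "low i t \<le> low_lim"
      if "T \<le> t" "t \<le> t'" "i \<in> correct" "low i t' \<le> low_lim" for i t t'
      using low_persists[OF _ T(2)[OF that(1)] that(2,3)] T(1) that y by (auto simp: min_le_iff_disj)
    show "1 \<le> card {i\<in>correct. low i t \<le> low_lim}" if "T \<le> t" for t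
    proof -
      obtain i where "i \<in> correct" "low i t = low_min t" using low_min_attained by blast
      moreover have "low_min t \<le> low_lim" using low_min_le_low_lim T(1) that by simp
      ultimately have "{i\<in>correct. low i t \<le> low_lim} \<noteq> {}" by auto
      then show ?thesis by (simp add: Suc_le_eq card_gt_0_iff)
    qed
  qed simp
  then obtain T' S where T': "T \<le> T'" and S: "S \<subseteq> correct" "1 \<le> card S"
    and S_low: "\<forall>t\<ge>T'. \<forall>i\<in>correct. i \<in> S \<longleftrightarrow> low i t \<le> low_lim"
    by blast
  have "0 \<le> T'" "S \<noteq> {}" using T(1) T' S(2) by auto
  then show ?thesis using S(1) S_low by blast
qed

lemma idle_if_not_rising:
  assumes i: "i \<in> correct" and ay: "a < y"
    and few: "card {j\<in>correct. pos j (look i k) < y} \<le> f"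
    and near: "a - \<eta> < pos i (look i k)" and \<eta>: "\<eta> < y - a" "\<eta> < \<delta> i"
    and stay: "pos i (look i (Suc k)) \<le> a"
  shows "cyc_dest i k = pos i (look i k) \<and> f < card {j. j < n \<and> pos j (look i k) < pos i (look i k)}"
proof -
  define l where "l = look i k"
  define x where "x = pos i l"
  have few2: "card {j. j < n \<and> pos j l < y} \<le> 2 * f"
    using card_below_le_f_plus_correct[of l y] few unfolding l_def by linarith
  have nx: "min x (cyc_dest i k) \<le> pos i (look i (Suc k))"
    using next_look_between[OF i, of k] unfolding x_def l_def by simp
  have xy: "x < y"
  proof (rule ccontr)
    assume "\<not> x < y"
    then have "min x y = y" by simp
    then have "y \<le> cyc_dest i k"
      using cyc_dest_ge_min[OF i few2[unfolded l_def]] unfolding x_def l_def by simp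
    then show False using nx \<open>\<not> x < y\<close> stay ay by (auto simp: min_le_iff_disj)
  qed
  have not_top: "card {j. j < n \<and> pos j l \<le> x} < n - f"
  proof -
    have "card correct \<le> card {j\<in>correct. pos j l < y} + card {j\<in>correct. y \<le> pos j l}"
      by (rule order_trans[OF _ card_Un_le]) (rule eq_imp_le, rule arg_cong[where f = card], auto)
    moreover have "card {j\<in>correct. y \<le> pos j l} \<le> card {j\<in>correct. x < pos j l}"
      using xy by (intro card_mono) auto
    moreover have "card {j\<in>correct. x < pos j l} \<le> n - card {j. j < n \<and> pos j l \<le> x}"
      by (rule card_correct_above_le)
    ultimately show ?thesis using few card_correct card_correct_gt_4f unfolding l_def by linarith
  qed
  have dest: "cyc_dest i k = algo n f (snapshot n pos l) x" unfolding l_def x_def by (rule cyc_dest_eq)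
  have not_bottom: "f < card {j. j < n \<and> pos j l < x}"
  proof (rule ccontr)
    assume "\<not> f < card {j. j < n \<and> pos j l < x}"
    then have "x \<le> cyc_dest i k \<and> (x + Pk (snapshot n pos l) (n - 2 * f)) / 2 \<le> cyc_dest i k"
      using algo_few_below[of f n pos l x] n_gt_5f dest by simp
    moreover have "y \<le> Pk (snapshot n pos l) (n - 2 * f)"
      using Pk_high_trim_ge[of f n pos l y] few2 n_gt_5f by simp
    ultimately have "a < cyc_dest i k" and "x \<le> cyc_dest i k"
      using near \<eta> unfolding x_def l_def by auto
    then have "min (cyc_dest i k) (x + \<delta> i) \<le> pos i (look i (Suc k))"
      using next_look_progress[OF i] unfolding x_def l_def by simp
    then show False using \<open>a < cyc_dest i k\<close> near \<eta> stay unfolding x_def l_def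
      by (auto simp: min_le_iff_disj)
  qed
  have "cyc_dest i k = x" using dest algo_idle[of f n pos l x] n_gt_5f not_bottom not_top by simp
  then show ?thesis using not_bottom unfolding x_def l_def by simp
qed

lemma low_lim_eq_robust_low: "low_lim = robust_low"
proof (rule ccontr)
  assume "low_lim \<noteq> robust_low"
  then have lt: "low_lim < robust_low" using low_lim_le_robust_low by simp
  define y where "y = (low_lim + robust_low) / 2"
  have y: "low_lim < y" "y < robust_low" unfolding y_def using lt by auto
  obtain T1 where T1: "0 \<le> T1" "\<And>t. T1 \<le> t \<Longrightarrow> card {j\<in>correct. pos j t < y} \<le> f"
    using eventually_few_pos_below[OF y(2)] by blast
  obtain dm where dm: "0 < dm" "\<And>i. i \<in> correct \<Longrightarrow> dm \<le> \<delta> i" using delta_lower_bound by blast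
  define \<eta> where "\<eta> = min ((y - low_lim) / 2) (dm / 2)"
  have "0 < \<eta>" "\<eta> < y - low_lim" "\<eta> < dm" unfolding \<eta>_def using y dm(1) by (auto simp: min_def)
  then have \<eta>: "0 < \<eta>" "\<eta> < y - low_lim" "\<And>i. i \<in> correct \<Longrightarrow> \<eta> < \<delta> i"
    using dm(2) by force+
  obtain T2 where T2: "0 \<le> T2" "\<And>t. T2 \<le> t \<Longrightarrow> low_lim - \<eta> < low_min t"
    using eventually_low_min_near_low_lim[OF \<eta>(1)] by blast
  obtain T3 S where T3: "0 \<le> T3" and S: "S \<subseteq> correct" "S \<noteq> {}"
    and S_low: "\<And>t i. T3 \<le> t \<Longrightarrow> i \<in> correct \<Longrightarrow> i \<in> S \<longleftrightarrow> low i t \<le> low_lim"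
    using eventually_bottom_group_stable[OF lt] by blast
  define T where "T = max T1 (max T2 T3)"
  have T: "0 \<le> T" "T1 \<le> T" "T2 \<le> T" "T3 \<le> T" unfolding T_def using T1 by auto
  have stay: "pos i (look i (Suc k)) \<le> low_lim" if iS: "i \<in> S" and lk: "T \<le> look i k" for i k
  proof (rule ccontr)
    assume "\<not> pos i (look i (Suc k)) \<le> low_lim"
    have iC: "i \<in> correct" using S iS by auto
    define v where "v = min (pos i (look i (Suc k))) y"
    have v: "low_lim < v" "v \<le> y" unfolding v_def using \<open>\<not> _ \<le> low_lim\<close> y by auto
    have cy: "v \<le> pos i (look i k') \<and> v \<le> cyc_dest i k'" if "Suc k \<le> k'" for k'
    proof (rule cycle_lower_bound_induct[OF iC _ _ that])
      show "v \<le> pos i (look i (Suc k))" unfolding v_def by simp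
      fix k'' assume kk: "Suc k \<le> k''" and vx: "v \<le> pos i (look i k'')"
      have "T1 \<le> look i k''" using look_mono[OF iC, of k k''] kk lk T by simp
      then have "card {j. j < n \<and> pos j (look i k'') < y} \<le> 2 * f"
        using T1(2) card_below_le_f_plus_correct[of "look i k''" y] by fastforce
      then have "min (pos i (look i k'')) y \<le> cyc_dest i k''" by (rule cyc_dest_ge_min[OF iC])
      then show "v \<le> cyc_dest i k''" using vx v by (auto simp: min_le_iff_disj)
    qed
    define t where "t = max (cmp i (Suc k)) T3"
    have "v \<le> low i t" using low_lower_bound_after[OF iC cy] unfolding t_def by simp
    moreover have "low i t \<le> low_lim" using S_low[of t i] iS iC unfolding t_def by simp
    ultimately show False using v by simp
  qed
  have idle: "cyc_dest i k = pos i (look i k) \<and> f < card {j. j < n \<and> pos j (look i k) < pos i (look i k)}"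
    if iS: "i \<in> S" and lk: "T \<le> look i k" for i k
  proof -
    have iC: "i \<in> correct" using S iS by auto
    show ?thesis
    proof (rule idle_if_not_rising[OF iC y(1) _ _ \<eta>(2) \<eta>(3)[OF iC] stay[OF iS lk]])
      show "card {j\<in>correct. pos j (look i k) < y} \<le> f" using T1(2) lk T by simp
      have "low_lim - \<eta> < low_min (look i k)" using T2(2) lk T by simp
      also have "\<dots> \<le> pos i (look i k)" using low_min_le[OF iC] low_le_pos order_trans by blast
      finally show "low_lim - \<eta> < pos i (look i k)" .
    qed
  qed
  have "\<exists>i\<in>S. \<exists>k. T \<le> look i k \<and> card {j. j < n \<and> pos j (look i k) < pos i (look i k)} \<le> f"
  proof (rule frozen_group_exposed[OF S T(1)])
    show "cyc_dest i k = pos i (look i k)" if "i \<in> S" "T \<le> look i k" for i k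
      using idle[OF that] by simp
    show "low i t < low j t" if "T \<le> t" "i \<in> S" "j \<in> correct" "j \<notin> S" for t i j
      using S_low[of t i] S_low[of t j] that S T by fastforce
  qed
  then obtain i k where "i \<in> S" "T \<le> look i k" "card {j. j < n \<and> pos j (look i k) < pos i (look i k)} \<le> f"
    by blast
  then show False using idle[of i k] by simp
qed

lemma eventually_cycle_after:
  "\<exists>T2\<ge>T1. \<forall>i\<in>correct. \<forall>t\<ge>T2. 0 < next_cycle i t \<and> T1 \<le> look i (next_cycle i t - 1)"
proof -
  obtain T2 k where T2: "T1 \<le> T2" "\<And>i. i \<in> correct \<Longrightarrow> T1 < look i (k i)"
    "\<And>i. i \<in> correct \<Longrightarrow> cmp i (k i) \<le> T2"
    using common_cycle_after[OF order_refl] by blast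
  have "0 < next_cycle i t \<and> T1 \<le> look i (next_cycle i t - 1)" if i: "i \<in> correct" and t: "T2 \<le> t" for i t
  proof -
    have "cmp i (k i) \<le> t" using T2(3)[OF i] t by simp
    then have "k i < next_cycle i t" using cmp_le_iff_less_next_cycle[OF i] by simp
    moreover have "look i (k i) \<le> look i (next_cycle i t - 1)"
      using look_mono[OF i] calculation by simp
    ultimately show ?thesis using T2(2)[OF i] by simp
  qed
  then show ?thesis using T2(1) by blast
qed

lemma pos_le_twice_dest_minus:
  assumes i: "i \<in> correct" and low: "\<And>j. j \<in> correct \<Longrightarrow> v \<le> pos j (look i k)"
  shows "pos i (look i k) \<le> 2 * cyc_dest i k - v"
proof -
  let ?l = "look i k"
  have "card {j. j < n \<and> pos j ?l < v} \<le> f"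
  proof (rule card_below_le_f_if_byzantine)
    fix j assume "j < n" "pos j ?l < v"
    then show "j \<in> B" using low[of j] by (cases "j \<in> B") auto
  qed
  then have "card {j. j < n \<and> pos j ?l < v} \<le> 2*f" by simp
  then have "min (pos i ?l) v \<le> cyc_dest i k" by (rule cyc_dest_ge_min[OF i])
  have R: "v \<le> Pk (snapshot n pos ?l) (2*f+1)"
    using Pk_low_trim_ge[of f n pos ?l v] n_gt_5f \<open>card {j. j < n \<and> pos j ?l < v} \<le> 2*f\<close> by simp
  define M where "M = min (pos i ?l) (Pk (snapshot n pos ?l) (2*f+1))"
  have h1: "(pos i ?l + M)/2 \<le> cyc_dest i k"
    unfolding M_def cyc_dest_eq by (rule algo_ge_half_low)
  have h2: "v \<le> M" unfolding M_def using R low[OF i] by simp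
  have h3: "pos i ?l + M \<le> 2 * cyc_dest i k" using h1 by simp
  have h4: "pos i ?l \<le> 2 * cyc_dest i k - M" using h3 by simp
  show ?thesis using h4 h2 by simp
qed

lemma card_correct_ge_le: "card {j \<in> correct. v \<le> pos j t} \<le> n - card {j. j < n \<and> pos j t < v}"
proof -
  have d: "{j. j < n \<and> pos j t < v} \<inter> {j \<in> correct. v \<le> pos j t} = {}" by auto
  have u: "{j. j < n \<and> pos j t < v} \<union> {j \<in> correct. v \<le> pos j t} \<subseteq> {..<n}" by auto
  have "card {j. j < n \<and> pos j t < v} + card {j \<in> correct. v \<le> pos j t}
      = card ({j. j < n \<and> pos j t < v} \<union> {j \<in> correct. v \<le> pos j t})"
    using d by (intro card_Un_disjoint[symmetric]) auto
  also have "\<dots> \<le> n" using card_mono[OF _ u] by simp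
  finally show ?thesis by simp
qed

lemma eventually_low_above:
  assumes e: "0 < e"
  shows "\<exists>T\<ge>0. \<forall>t\<ge>T. \<forall>i\<in>correct. robust_low - e < low i t"
proof -
  obtain T where T: "0 \<le> T" "\<And>t. T \<le> t \<Longrightarrow> low_lim - e < low_min t" using eventually_low_min_near_low_lim[OF e] by blast
  have "robust_low - e < low i t" if "T \<le> t" "i \<in> correct" for t i
    using T(2)[OF that(1)] low_min_le[OF that(2), of t] low_lim_eq_robust_low by simp
  then show ?thesis using T(1) by blast
qed

lemma eventually_pos_near_low:
  assumes e: "0 < e"
  shows "\<exists>T\<ge>0. \<forall>t\<ge>T. \<forall>i\<in>correct. low i t < robust_low + e \<longrightarrow> pos i t < robust_low + 3*e"
proof -
  obtain T1 where T1: "0 \<le> T1" "\<And>t i. T1 \<le> t \<Longrightarrow> i \<in> correct \<Longrightarrow> robust_low - e < low i t"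
    using eventually_low_above[OF e] by blast
  have xb: "pos i (look i k) \<le> 2 * cyc_dest i k - (robust_low - e)" if i: "i \<in> correct" and lk: "T1 \<le> look i k" for i k
  proof (rule pos_le_twice_dest_minus[OF i])
    fix j assume j: "j \<in> correct"
    show "robust_low - e \<le> pos j (look i k)" using T1(2)[OF lk j] low_le_pos[of j "look i k"] by simp
  qed
  obtain T2 where T2: "T1 \<le> T2" "\<And>i t. i \<in> correct \<Longrightarrow> T2 \<le> t \<Longrightarrow> 0 < next_cycle i t \<and> T1 \<le> look i (next_cycle i t - 1)"
    using eventually_cycle_after by blast
  have "pos i t < robust_low + 3*e" if t: "T2 \<le> t" and i: "i \<in> correct" and lw: "low i t < robust_low + e" for t i
  proof -
    have t0: "0 \<le> t" using T1(1) T2(1) t by simp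
    obtain K where K: "next_cycle i t = Suc K" and lK: "T1 \<le> look i K" using T2(2)[OF i t] by (cases "next_cycle i t") auto
    have "pos i t < robust_low + e \<or> dest_at n f pos look cmp i t < robust_low + e \<or> pending_dest i t < robust_low + e"
      using lw unfolding low_def by (auto simp: min_less_iff_disj)
    moreover {
      assume "dest_at n f pos look cmp i t < robust_low + e"
      then have d: "cyc_dest i K < robust_low + e" using dest_at_next_cycle[OF i] K by simp
      have "pos i (look i K) \<le> 2 * cyc_dest i K - (robust_low - e)" by (rule xb[OF i lK])
      then have "pos i (look i K) < robust_low + 3 * e" using d by simp
      moreover have "pos i t \<le> max (pos i (look i K)) (cyc_dest i K)" using pos_between_last_look_dest[OF i K] by simp
      ultimately have ?thesis using d e by (auto simp: le_max_iff_disj)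
    }
    moreover {
      assume pe: "pending_dest i t < robust_low + e"
      have ?thesis
      proof (cases "look i (next_cycle i t) \<le> t")
        case True
        then have d: "cyc_dest i (next_cycle i t) < robust_low + e" using pe unfolding pending_dest_def by simp
        have "look i K \<le> look i (next_cycle i t)" using look_mono[OF i] K by simp
        then have "T1 \<le> look i (next_cycle i t)" using lK by simp
        then have "pos i (look i (next_cycle i t)) \<le> 2 * cyc_dest i (next_cycle i t) - (robust_low - e)" by (rule xb[OF i])
        moreover have "pos i t = pos i (look i (next_cycle i t))" using pos_eq_pending_look[OF i t0 True] .
        ultimately show ?thesis using d by simp
      next
        case False
        then show ?thesis using pe e unfolding pending_dest_def by simp
      qed
    }
    ultimately show ?thesis using e by auto
  qed
  then show ?thesis using T1(1) T2(1) by (intro exI[of _ T2]) auto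
qed

lemma eventually_many_pos_below:
  assumes e: "0 < e"
  shows "\<exists>T\<ge>0. \<forall>t\<ge>T. f < card {i\<in>correct. pos i t < robust_low + 3*e}"
proof -
  obtain T where T: "0 \<le> T" "\<And>t i. T \<le> t \<Longrightarrow> i \<in> correct \<Longrightarrow> low i t < robust_low + e \<Longrightarrow> pos i t < robust_low + 3*e"
    using eventually_pos_near_low[OF e] by blast
  have "f < card {i\<in>correct. pos i t < robust_low + 3*e}" if t: "T \<le> t" for t
  proof -
    have "f < card {i\<in>correct. low i t < robust_low + e}" using many_low_below[of "robust_low + e" t] e T(1) t by simp
    also have "\<dots> \<le> card {i\<in>correct. pos i t < robust_low + 3*e}" using T(2)[OF t] by (intro card_mono) auto
    finally show ?thesis .
  qed
  then show ?thesis using T(1) by blast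
qed

lemma eventually_not_top_below:
  assumes H: "\<exists>T\<ge>0. \<forall>t\<ge>T. f < card {i\<in>correct. z < pos i t}"
  shows "\<exists>T\<ge>0. \<forall>i\<in>correct. \<forall>k. T \<le> look i k \<longrightarrow> pos i (look i k) < z \<longrightarrow>
    card {j. j < n \<and> pos j (look i k) \<le> pos i (look i k)} < n - f"
proof -
  obtain T where T: "0 \<le> T" "\<And>t. T \<le> t \<Longrightarrow> f < card {i\<in>correct. z < pos i t}" using H by blast
  have "card {j. j < n \<and> pos j l \<le> x} < n - f" if "T \<le> l" "x < z" for l x
  proof -
    have "card {j\<in>correct. z < pos j l} \<le> card {j\<in>correct. x < pos j l}"
      using \<open>x < z\<close> by (intro card_mono) auto
    also have "\<dots> \<le> n - card {j. j < n \<and> pos j l \<le> x}" by (rule card_correct_above_le)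
    finally show ?thesis using T(2)[OF \<open>T \<le> l\<close>] by linarith
  qed
  then show ?thesis using T(1) by blast
qed

lemma eventually_dest_ge_level:
  assumes e: "0 < e" and z: "robust_low + 3 * e \<le> z"
    and H: "\<exists>T\<ge>0. \<forall>t\<ge>T. f < card {i\<in>correct. z < pos i t}"
  shows "\<exists>T\<ge>0. \<forall>i\<in>correct. \<forall>k. T \<le> look i k \<longrightarrow>
    robust_low + e \<le> pos i (look i k) \<longrightarrow> robust_low + e \<le> cyc_dest i k"
proof -
  obtain T1 where T1: "0 \<le> T1" "\<And>t i. T1 \<le> t \<Longrightarrow> i \<in> correct \<Longrightarrow> robust_low - e < low i t"
    using eventually_low_above[OF e] by blast
  obtain T2 where T2: "0 \<le> T2" and not_top: "\<And>i k. i \<in> correct \<Longrightarrow> T2 \<le> look i k \<Longrightarrow>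
      pos i (look i k) < z \<Longrightarrow> card {j. j < n \<and> pos j (look i k) \<le> pos i (look i k)} < n - f"
    using eventually_not_top_below[OF H] by blast
  have "robust_low + e \<le> cyc_dest i k"
    if i: "i \<in> correct" and lk: "max T1 T2 \<le> look i k" and x: "robust_low + e \<le> pos i (look i k)" for i k
  proof (cases "pos i (look i k) < z")
    case True
    then have "pos i (look i k) \<le> cyc_dest i k"
      using algo_ge_if_not_top[of f n pos "look i k"] n_gt_5f not_top[OF i _ True] lk cyc_dest_eq by simp
    then show ?thesis using x by simp
  next
    case False
    have "pos i (look i k) \<le> 2 * cyc_dest i k - (robust_low - e)"
    proof (rule pos_le_twice_dest_minus[OF i])
      show "robust_low - e \<le> pos j (look i k)" if "j \<in> correct" for j
        using T1(2)[OF _ that] low_le_pos[of j "look i k"] lk by fastforce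
    qed
    then show ?thesis using False z by simp
  qed
  then show ?thesis using T1(1) by (intro exI[of _ "max T1 T2"]) auto
qed

lemma eventually_low_group_stable:
  assumes e: "0 < e" and z: "robust_low + 3 * e \<le> z"
    and H: "\<exists>T\<ge>0. \<forall>t\<ge>T. f < card {i\<in>correct. z < pos i t}"
  obtains T S where "0 \<le> T" "S \<subseteq> correct" "f < card S"
    "\<And>t i. T \<le> t \<Longrightarrow> i \<in> correct \<Longrightarrow> i \<in> S \<longleftrightarrow> low i t < robust_low + e"
proof -
  obtain T where T: "0 \<le> T" and up: "\<And>i k. i \<in> correct \<Longrightarrow> T \<le> look i k \<Longrightarrow>
      robust_low + e \<le> pos i (look i k) \<Longrightarrow> robust_low + e \<le> cyc_dest i k"
    using eventually_dest_ge_level[OF e z H] by blast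
  have "\<exists>T'\<ge>T. \<exists>S. S \<subseteq> correct \<and> Suc f \<le> card S \<and>
      (\<forall>t\<ge>T'. \<forall>i\<in>correct. i \<in> S \<longleftrightarrow> low i t < robust_low + e)"
  proof (rule shrinking_filter_stabilizes)
    show "low i t < robust_low + e"
      if tt: "T \<le> t" "t \<le> t'" and i: "i \<in> correct" and lt: "low i t' < robust_low + e" for i t t'
    proof (rule ccontr)
      assume "\<not> low i t < robust_low + e"
      have "robust_low + e \<le> low i t'"
      proof (rule lower_bound_invariant[of "{i}" t "\<lambda>_. robust_low + e" i t'])
        show "robust_low + e \<le> cyc_dest j k"
          if "j \<in> {i}" "t < look j k" "\<And>j'. j' \<in> {i} \<Longrightarrow> robust_low + e \<le> pos j' (look j k)" for j k
          using up[of j k] that i tt by simp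
      qed (use i tt T \<open>\<not> low i t < robust_low + e\<close> in auto)
      then show False using lt by simp
    qed
    show "Suc f \<le> card {i\<in>correct. low i t < robust_low + e}" if "T \<le> t" for t
      using many_low_below[of "robust_low + e" t] e T that by simp
  qed simp
  then obtain T' S where T': "T \<le> T'" and S: "S \<subseteq> correct" "Suc f \<le> card S"
    and S_low: "\<forall>t\<ge>T'. \<forall>i\<in>correct. i \<in> S \<longleftrightarrow> low i t < robust_low + e"
    by blast
  show ?thesis
  proof (rule that[of T' S])
    show "i \<in> S \<longleftrightarrow> low i t < robust_low + e" if "T' \<le> t" "i \<in> correct" for t i
      using S_low that by blast
  qed (use T T' S in auto)
qed

lemma eventually_low_group_below:
  assumes e: "0 < e" and z: "robust_low + 3 * e \<le> z"
    and H: "\<exists>T\<ge>0. \<forall>t\<ge>T. f < card {i\<in>correct. z < pos i t}"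
  obtains T S where "0 \<le> T" "S \<subseteq> correct" "f < card S"
    "\<And>t i. T \<le> t \<Longrightarrow> i \<in> correct \<Longrightarrow> i \<in> S \<longleftrightarrow> low i t < robust_low + e"
    "\<And>t i. T \<le> t \<Longrightarrow> i \<in> S \<Longrightarrow> pos i t < robust_low + e"
proof -
  obtain T1 S where T1: "0 \<le> T1" and S: "S \<subseteq> correct" "f < card S"
    and S_low: "\<And>t i. T1 \<le> t \<Longrightarrow> i \<in> correct \<Longrightarrow> i \<in> S \<longleftrightarrow> low i t < robust_low + e"
    using eventually_low_group_stable[OF e z H] by blast
  obtain T2 where T2: "0 \<le> T2" and near: "\<And>t i. T2 \<le> t \<Longrightarrow> i \<in> correct \<Longrightarrow>
      low i t < robust_low + e \<Longrightarrow> pos i t < robust_low + 3 * e"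
    using eventually_pos_near_low[OF e] by blast
  obtain T3 where T3: "0 \<le> T3" and not_top: "\<And>i k. i \<in> correct \<Longrightarrow> T3 \<le> look i k \<Longrightarrow>
      pos i (look i k) < z \<Longrightarrow> card {j. j < n \<and> pos j (look i k) \<le> pos i (look i k)} < n - f"
    using eventually_not_top_below[OF H] by blast
  define T where "T = max T1 (max T2 T3)"
  have ascending: "pos i (look i k) \<le> cyc_dest i k" if i: "i \<in> S" and lk: "T \<le> look i k" for i k
  proof -
    have iC: "i \<in> correct" using S i by auto
    have "pos i (look i k) < z" using near[of "look i k" i] S_low[of "look i k" i] i iC lk z
      unfolding T_def by simp
    then show ?thesis
      using algo_ge_if_not_top[of f n pos "look i k"] n_gt_5f not_top[OF iC] lk cyc_dest_eq
      unfolding T_def by simp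
  qed
  obtain T' k where T': "T \<le> T'" "\<And>i. i \<in> S \<Longrightarrow> T < look i (k i)" "\<And>i. i \<in> S \<Longrightarrow> cmp i (k i) \<le> T'"
    using common_cycle_after[OF S(1)] by blast
  have S_pos: "pos i t < robust_low + e" if i: "i \<in> S" and t: "T' \<le> t" for i t
  proof -
    have iC: "i \<in> correct" using S i by auto
    have "pos i (look i k') \<le> cyc_dest i k'" if "k i \<le> k'" for k'
      using ascending[OF i] look_mono[OF iC that] T'(2)[OF i] by simp
    then have "low i t = pos i t"
      using low_eq_pos_if_ascending[OF iC _ order_trans[OF T'(3)[OF i] t]] by blast
    then show ?thesis using S_low[of t i] i iC t T' unfolding T_def by simp
  qed
  show ?thesis
  proof (rule that[of T' S])
    show "i \<in> S \<longleftrightarrow> low i t < robust_low + e" if "T' \<le> t" "i \<in> correct" for t i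
      using S_low[of t i] T'(1) that unfolding T_def by simp
  qed (use S S_pos T1 T'(1) in \<open>auto simp: T_def\<close>)
qed

lemma frequently_few_high:
  assumes e: "0 < e" and \<delta>: "\<And>i. i \<in> correct \<Longrightarrow> 2 * e < \<delta> i" and z: "robust_low + 3 * e \<le> z"
    and H: "\<exists>T\<ge>0. \<forall>t\<ge>T. f < card {i\<in>correct. z < pos i t}"
  shows "\<exists>l\<ge>T0. card {j\<in>correct. robust_low + 3 * e \<le> pos j l} \<le> 2 * f"
proof (rule ccontr)
  assume many_high: "\<not> (\<exists>l\<ge>T0. card {j\<in>correct. robust_low + 3 * e \<le> pos j l} \<le> 2 * f)"
  obtain T1 S where T1: "0 \<le> T1" and S: "S \<subseteq> correct" "f < card S"
    and S_low: "\<And>t i. T1 \<le> t \<Longrightarrow> i \<in> correct \<Longrightarrow> i \<in> S \<longleftrightarrow> low i t < robust_low + e"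
    and S_pos: "\<And>t i. T1 \<le> t \<Longrightarrow> i \<in> S \<Longrightarrow> pos i t < robust_low + e"
    using eventually_low_group_below[OF e z H] by blast
  obtain T2 where T2: "0 \<le> T2" "\<And>t i. T2 \<le> t \<Longrightarrow> i \<in> correct \<Longrightarrow> robust_low - e < low i t"
    using eventually_low_above[OF e] by blast
  obtain T3 where T3: "0 \<le> T3" and not_top: "\<And>i k. i \<in> correct \<Longrightarrow> T3 \<le> look i k \<Longrightarrow>
      pos i (look i k) < z \<Longrightarrow> card {j. j < n \<and> pos j (look i k) \<le> pos i (look i k)} < n - f"
    using eventually_not_top_below[OF H] by blast
  define T where "T = max T0 (max T1 (max T2 T3))"
  have T: "0 \<le> T" "T0 \<le> T" "T1 \<le> T" "T2 \<le> T" "T3 \<le> T" unfolding T_def using T1 by auto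
  have idle: "cyc_dest i k = pos i (look i k) \<and> f < card {j. j < n \<and> pos j (look i k) < pos i (look i k)}"
    if i: "i \<in> S" and lk: "T \<le> look i k" for i k
  proof -
    have iC: "i \<in> correct" using S i by auto
    define l where "l = look i k"
    define x where "x = pos i l"
    have lT: "T0 \<le> l" "T1 \<le> l" "T2 \<le> l" "T3 \<le> l" using lk T unfolding l_def by auto
    have dest: "cyc_dest i k = algo n f (snapshot n pos l) x" unfolding l_def x_def by (rule cyc_dest_eq)
    have "robust_low - e < low i l" using T2(2)[OF lT(3) iC] .
    then have x: "robust_low - e < x" "x < robust_low + e"
      using low_le_pos[of i l] S_pos[OF lT(2) i] unfolding x_def by linarith+
    have "T1 \<le> look i (Suc k)" using look_mono[OF iC, of k "Suc k"] lT(2) unfolding l_def by simp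
    then have next_low: "pos i (look i (Suc k)) < robust_low + e" using S_pos[OF _ i] by blast
    have not_bottom: "f < card {j. j < n \<and> pos j l < x}"
    proof (rule ccontr)
      assume "\<not> f < card {j. j < n \<and> pos j l < x}"
      then have db: "x \<le> cyc_dest i k \<and> (x + Pk (snapshot n pos l) (n - 2 * f)) / 2 \<le> cyc_dest i k"
        using algo_few_below[of f n pos l x] n_gt_5f dest by simp
      have "min (cyc_dest i k) (x + \<delta> i) \<le> pos i (look i (Suc k))"
        using next_look_progress[OF iC] db unfolding x_def l_def by simp
      moreover have "robust_low + e < x + \<delta> i" using x \<delta>[OF iC] by simp
      ultimately have "cyc_dest i k < robust_low + e" using next_low by (auto simp: min_le_iff_disj)
      then have "Pk (snapshot n pos l) (n - 2 * f) < robust_low + 3 * e" using db x by simp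
      then have "n - 2 * f \<le> card {j. j < n \<and> pos j l < robust_low + 3 * e}"
        using Pk_high_trim_less[of f n pos l] n_gt_5f by simp
      then have "card {j\<in>correct. robust_low + 3 * e \<le> pos j l} \<le> 2 * f"
        using card_correct_ge_le[of "robust_low + 3 * e" l] by linarith
      then show False using many_high lT(1) by blast
    qed
    have "x < z" using x e z by simp
    then have not_top: "card {j. j < n \<and> pos j l \<le> x} < n - f"
      using not_top[OF iC lT(4)[unfolded l_def]] unfolding x_def l_def by simp
    have "cyc_dest i k = x" using dest algo_idle[of f n pos l x] n_gt_5f not_bottom not_top by simp
    then show ?thesis using not_bottom unfolding x_def l_def by simp
  qed
  have "\<exists>i\<in>S. \<exists>k. T \<le> look i k \<and> card {j. j < n \<and> pos j (look i k) < pos i (look i k)} \<le> f"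
  proof (rule frozen_group_exposed[OF S(1) _ T(1)])
    show "S \<noteq> {}" using S(2) by auto
    show "cyc_dest i k = pos i (look i k)" if "i \<in> S" "T \<le> look i k" for i k
      using idle[OF that] by simp
    show "low i t < low j t" if "T \<le> t" "i \<in> S" "j \<in> correct" "j \<notin> S" for t i j
      using S_low[of t i] S_low[of t j] that S T by fastforce
  qed
  then obtain i k where "i \<in> S" "T \<le> look i k" "card {j. j < n \<and> pos j (look i k) < pos i (look i k)} \<le> f"
    by blast
  then show False using idle[of i k] by simp
qed

lemma eventually_frozen_between:
  assumes L: "L \<subseteq> correct" "f < card L" and H: "H \<subseteq> correct" "f < card H"
    and L_pos: "\<And>t i. T \<le> t \<Longrightarrow> i \<in> L \<Longrightarrow> pos i t < c"
    and not_L_pos: "\<And>t j. T \<le> t \<Longrightarrow> j \<in> correct - L \<Longrightarrow> c \<le> pos j t"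
    and H_pos: "\<And>t i. T \<le> t \<Longrightarrow> i \<in> H \<Longrightarrow> d < pos i t"
    and not_H_pos: "\<And>t j. T \<le> t \<Longrightarrow> j \<in> correct - H \<Longrightarrow> pos j t \<le> d"
  shows "\<exists>T'. \<exists>p. \<forall>t\<ge>T'. \<forall>j\<in>correct - L - H. pos j t = p j"
proof -
  have idle: "cyc_dest j k = pos j (look j k)" if j: "j \<in> correct - L - H" and lk: "T \<le> look j k" for j k
  proof -
    define l where "l = look j k"
    define x where "x = pos j l"
    have l: "T \<le> l" using lk unfolding l_def .
    have "L \<subseteq> {i\<in>correct. pos i l < x}"
    proof
      fix i assume "i \<in> L"
      moreover have "c \<le> x" using not_L_pos[OF l] j unfolding x_def by simp
      ultimately show "i \<in> {i\<in>correct. pos i l < x}" using L_pos[OF l] L(1) by fastforce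
    qed
    then have "card L \<le> card {i\<in>correct. pos i l < x}" by (intro card_mono) auto
    also have "\<dots> \<le> card {i. i < n \<and> pos i l < x}" by (rule card_correct_below_le)
    finally have not_bottom: "f < card {i. i < n \<and> pos i l < x}" using L(2) by simp
    have "H \<subseteq> {i\<in>correct. x < pos i l}"
    proof
      fix i assume "i \<in> H"
      moreover have "x \<le> d" using not_H_pos[OF l] j unfolding x_def by simp
      ultimately show "i \<in> {i\<in>correct. x < pos i l}" using H_pos[OF l] H(1) by fastforce
    qed
    then have "card H \<le> card {i\<in>correct. x < pos i l}" by (intro card_mono) auto
    also have "\<dots> \<le> n - card {i. i < n \<and> pos i l \<le> x}" by (rule card_correct_above_le)
    finally have not_top: "card {i. i < n \<and> pos i l \<le> x} < n - f" using H(2) by linarith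
    show ?thesis
      using cyc_dest_eq algo_idle[of f n pos l x] n_gt_5f not_bottom not_top unfolding x_def l_def by simp
  qed
  have sub: "correct - L - H \<subseteq> correct" by blast
  obtain T' k where "T \<le> T'" and T': "\<And>j. j \<in> correct - L - H \<Longrightarrow> T < look j (k j)"
    "\<And>j. j \<in> correct - L - H \<Longrightarrow> cmp j (k j) \<le> T'"
    using common_cycle_after[OF sub, where T = T] by blast
  have "pos j t = pos j (look j (k j))" if j: "j \<in> correct - L - H" and t: "T' \<le> t" for j t
  proof -
    have jC: "j \<in> correct" using j by simp
    have "cyc_dest j k' = pos j (look j k')" if "k j \<le> k'" for k'
      using idle[OF j] look_mono[OF jC that] T'(1)[OF j] by simp
    then show ?thesis using pos_frozen[OF jC _ order_trans[OF T'(2)[OF j] t]] by blast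
  qed
  then show ?thesis by (intro exI[of _ T'] exI[of _ "\<lambda>j. pos j (look j (k j))"]) simp
qed

lemma eventually_pos_split_low:
  assumes e: "0 < e" and z: "robust_low + 3 * e \<le> z"
    and H: "\<exists>T\<ge>0. \<forall>t\<ge>T. f < card {i\<in>correct. z < pos i t}"
  obtains T L where "L \<subseteq> correct" "f < card L"
    "\<And>t i. T \<le> t \<Longrightarrow> i \<in> L \<Longrightarrow> pos i t < robust_low + e"
    "\<And>t j. T \<le> t \<Longrightarrow> j \<in> correct - L \<Longrightarrow> robust_low + e \<le> pos j t"
proof -
  obtain T L where "0 \<le> T" and L: "L \<subseteq> correct" "f < card L"
    and L_low: "\<And>t i. T \<le> t \<Longrightarrow> i \<in> correct \<Longrightarrow> i \<in> L \<longleftrightarrow> low i t < robust_low + e"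
    and L_pos: "\<And>t i. T \<le> t \<Longrightarrow> i \<in> L \<Longrightarrow> pos i t < robust_low + e"
    using eventually_low_group_below[OF e z H] by blast
  show ?thesis
  proof (rule that[OF L L_pos])
    show "robust_low + e \<le> pos j t" if "T \<le> t" "j \<in> correct - L" for t j
      using L_low[of t j] low_le_pos[of j t] that by fastforce
  qed
qed

abbreviation robust_high where "robust_high \<equiv> - corda_run.robust_low n f B (mirror pos) look cmp"

lemma eventually_many_pos_above:
  assumes e: "0 < e"
  shows "\<exists>T\<ge>0. \<forall>t\<ge>T. f < card {i\<in>correct. robust_high - 3 * e < pos i t}"
proof -
  interpret N: corda_run n f B \<delta> "mirror pos" look cmp mend by (rule mirror_run)
  have "{i\<in>correct. mirror pos i t < N.robust_low + 3 * e} = {i\<in>correct. robust_high - 3 * e < pos i t}"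
    for t by (auto simp: mirror_def)
  then show ?thesis using N.eventually_many_pos_below[OF e] by simp
qed

lemma mirror_many_below:
  assumes "\<exists>T\<ge>0. \<forall>t\<ge>T. f < card {i\<in>correct. pos i t < z}"
  shows "\<exists>T\<ge>0. \<forall>t\<ge>T. f < card {i\<in>correct. - z < mirror pos i t}"
  using assms by (simp add: mirror_def)

lemma eventually_pos_split_high:
  assumes e: "0 < e" and z: "z \<le> robust_high - 3 * e"
    and H: "\<exists>T\<ge>0. \<forall>t\<ge>T. f < card {i\<in>correct. pos i t < z}"
  obtains T U where "U \<subseteq> correct" "f < card U"
    "\<And>t i. T \<le> t \<Longrightarrow> i \<in> U \<Longrightarrow> robust_high - e < pos i t"
    "\<And>t j. T \<le> t \<Longrightarrow> j \<in> correct - U \<Longrightarrow> pos j t \<le> robust_high - e"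
proof -
  interpret N: corda_run n f B \<delta> "mirror pos" look cmp mend by (rule mirror_run)
  have z': "N.robust_low + 3 * e \<le> - z" using z by simp
  show ?thesis
  proof (rule N.eventually_pos_split_low[OF e z' mirror_many_below[OF H]])
    fix T U assume U: "U \<subseteq> correct" "f < card U"
      and U_pos: "\<And>t i. T \<le> t \<Longrightarrow> i \<in> U \<Longrightarrow> mirror pos i t < N.robust_low + e"
      and U_not: "\<And>t j. T \<le> t \<Longrightarrow> j \<in> correct - U \<Longrightarrow> N.robust_low + e \<le> mirror pos j t"
    show thesis
    proof (rule that[OF U])
      show "robust_high - e < pos i t" if "T \<le> t" "i \<in> U" for t i
        using U_pos[OF that] by (simp add: mirror_def)
      show "pos j t \<le> robust_high - e" if "T \<le> t" "j \<in> correct - U" for t j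
        using U_not[OF that] by (simp add: mirror_def)
    qed
  qed
qed

lemma frequently_few_low:
  assumes e: "0 < e" and \<delta>: "\<And>i. i \<in> correct \<Longrightarrow> 2 * e < \<delta> i" and z: "z \<le> robust_high - 3 * e"
    and H: "\<exists>T\<ge>0. \<forall>t\<ge>T. f < card {i\<in>correct. pos i t < z}"
  shows "\<exists>l\<ge>T0. card {j\<in>correct. pos j l \<le> robust_high - 3 * e} \<le> 2 * f"
proof -
  interpret N: corda_run n f B \<delta> "mirror pos" look cmp mend by (rule mirror_run)
  have z': "N.robust_low + 3 * e \<le> - z" using z by simp
  have "{j\<in>correct. N.robust_low + 3 * e \<le> mirror pos j l} = {j\<in>correct. pos j l \<le> robust_high - 3 * e}"
    for l by (auto simp: mirror_def)
  then show ?thesis using N.frequently_few_high[OF e \<delta> z' mirror_many_below[OF H]] by simp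
qed

lemma lower_part_not_frozen:
  assumes cd: "c \<le> d"
    and frozen: "\<And>t. T \<le> t \<Longrightarrow> {i\<in>correct. pos i t < c} = {i\<in>correct. pos i T < c}"
    and few_high: "\<exists>l\<ge>T. card {j\<in>correct. c \<le> pos j l} \<le> 2 * f"
    and few_low: "\<exists>l\<ge>T. card {j\<in>correct. pos j l \<le> d} \<le> 2 * f"
  shows False
proof -
  define below where "below t = {i\<in>correct. pos i t < c}" for t
  obtain l1 where l1: "T \<le> l1" "card {j\<in>correct. c \<le> pos j l1} \<le> 2 * f" using few_high by blast
  obtain l2 where l2: "T \<le> l2" "card {j\<in>correct. pos j l2 \<le> d} \<le> 2 * f" using few_low by blast
  have "below l1 \<union> {j\<in>correct. c \<le> pos j l1} = correct"
    unfolding below_def by auto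
  then have "card correct \<le> card (below l1) + card {j\<in>correct. c \<le> pos j l1}"
    using card_Un_le[of "below l1" "{j\<in>correct. c \<le> pos j l1}"] by simp
  moreover have "card (below l2) \<le> card {j\<in>correct. pos j l2 \<le> d}"
    using cd unfolding below_def by (intro card_mono) auto
  moreover have "below l1 = below l2" using frozen[OF l1(1)] frozen[OF l2(1)] unfolding below_def by simp
  ultimately have "card correct \<le> 4 * f" using l1(2) l2(2) by simp
  then show False using card_correct_gt_4f by simp
qed

lemma stable_split_impossible:
  assumes L: "L \<subseteq> correct" "f < card L" and U: "U \<subseteq> correct" "f < card U"
    and L_pos: "\<And>t i. Ts \<le> t \<Longrightarrow> i \<in> L \<Longrightarrow> pos i t < a"
    and not_L_pos: "\<And>t j. Ts \<le> t \<Longrightarrow> j \<in> correct - L \<Longrightarrow> a \<le> pos j t"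
    and U_pos: "\<And>t i. Ts \<le> t \<Longrightarrow> i \<in> U \<Longrightarrow> b < pos i t"
    and not_U_pos: "\<And>t j. Ts \<le> t \<Longrightarrow> j \<in> correct - U \<Longrightarrow> pos j t \<le> b"
    and levels: "a < c" "c \<le> d" "d < b"
    and few_high: "\<And>t. \<exists>l\<ge>t. card {j\<in>correct. c \<le> pos j l} \<le> 2 * f"
    and few_low: "\<And>t. \<exists>l\<ge>t. card {j\<in>correct. pos j l \<le> d} \<le> 2 * f"
  shows False
proof -
  have "\<exists>T1. \<exists>p. \<forall>t\<ge>T1. \<forall>j\<in>correct - L - U. pos j t = p j"
    by (rule eventually_frozen_between[OF L U L_pos not_L_pos U_pos not_U_pos])
  then obtain T1 p where frozen: "\<And>t j. T1 \<le> t \<Longrightarrow> j \<in> correct - L - U \<Longrightarrow> pos j t = p j"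
    by blast
  define T where "T = max Ts T1"
  have "{i\<in>correct. pos i t < c} = {i\<in>correct. pos i T < c}" if "T \<le> t" for t
  proof -
    have tT: "Ts \<le> t" "T1 \<le> t" "Ts \<le> T" "T1 \<le> T" using that unfolding T_def by auto
    have "pos i t < c \<longleftrightarrow> pos i T < c" if i: "i \<in> correct" for i
    proof -
      consider "i \<in> L" | "i \<in> U" | "i \<in> correct - L - U" using i by blast
      then show ?thesis
      proof cases
        case 1
        then show ?thesis using L_pos[OF tT(1)] L_pos[OF tT(3)] levels by fastforce
      next
        case 2
        then show ?thesis using U_pos[OF tT(1)] U_pos[OF tT(3)] levels by fastforce
      next
        case 3
        then show ?thesis using frozen[OF tT(2)] frozen[OF tT(4)] by simp
      qed
    qed
    then show ?thesis by blast
  qed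
  then show False by (rule lower_part_not_frozen[OF levels(2) _ few_high few_low])
qed

lemma robust_low_le_robust_high: "robust_low \<le> robust_high"
proof -
  interpret N: corda_run n f B \<delta> "mirror pos" look cmp mend by (rule mirror_run)
  obtain i where i: "i \<in> correct" using correct_nonempty by blast
  have low_min_le: "low_min t \<le> - N.low_min t" for t
    using low_min_le[OF i, of t] low_le_pos[of i t] N.low_min_le[OF i, of t] N.low_le_pos[of i t]
    by (simp add: mirror_def)
  show ?thesis
  proof (rule field_le_epsilon)
    fix e :: real assume "0 < e"
    then have e: "0 < e / 2" by simp
    obtain T1 where T1: "\<And>t. T1 \<le> t \<Longrightarrow> low_lim - e / 2 < low_min t"
      using eventually_low_min_near_low_lim[OF e] by blast
    obtain T2 where T2: "\<And>t. T2 \<le> t \<Longrightarrow> N.low_lim - e / 2 < N.low_min t"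
      using N.eventually_low_min_near_low_lim[OF e] by blast
    have "low_lim - e / 2 < - (N.low_lim - e / 2)"
      using T1[of "max T1 T2"] T2[of "max T1 T2"] low_min_le[of "max T1 T2"] by simp
    then show "robust_low \<le> robust_high + e"
      using low_lim_eq_robust_low N.low_lim_eq_robust_low by simp
  qed
qed

lemma robust_low_eq_robust_high: "robust_low = robust_high"
proof (rule ccontr)
  assume "robust_low \<noteq> robust_high"
  then have lt: "robust_low < robust_high" using robust_low_le_robust_high by simp
  obtain dm where dm: "0 < dm" "\<And>i. i \<in> correct \<Longrightarrow> dm \<le> \<delta> i" using delta_lower_bound by blast
  define e where "e = min ((robust_high - robust_low) / 8) (dm / 4)"
  have e_le: "e \<le> (robust_high - robust_low) / 8" "e \<le> dm / 4"
    unfolding e_def by (rule min.cobounded1, rule min.cobounded2)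
  have e: "0 < e" using lt dm(1) unfolding e_def by simp
  have "8 * e \<le> robust_high - robust_low" using e_le(1) by simp
  then have gap: "robust_low + 3 * e \<le> robust_high - 3 * e" using e by linarith
  have \<delta>: "2 * e < \<delta> i" if "i \<in> correct" for i using e_le(2) dm(1) dm(2)[OF that] by linarith
  note many_above = eventually_many_pos_above[OF e] and many_below = eventually_many_pos_below[OF e]
  show False
  proof (rule eventually_pos_split_low[OF e gap many_above])
    fix T1 L assume L: "L \<subseteq> correct" "f < card L"
      and L_pos: "\<And>t i. T1 \<le> t \<Longrightarrow> i \<in> L \<Longrightarrow> pos i t < robust_low + e"
      and not_L_pos: "\<And>t j. T1 \<le> t \<Longrightarrow> j \<in> correct - L \<Longrightarrow> robust_low + e \<le> pos j t"
    show False
    proof (rule eventually_pos_split_high[OF e gap many_below])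
      fix T2 U assume U: "U \<subseteq> correct" "f < card U"
        and U_pos: "\<And>t i. T2 \<le> t \<Longrightarrow> i \<in> U \<Longrightarrow> robust_high - e < pos i t"
        and not_U_pos: "\<And>t j. T2 \<le> t \<Longrightarrow> j \<in> correct - U \<Longrightarrow> pos j t \<le> robust_high - e"
      show False
      proof (rule stable_split_impossible[OF L U, where Ts = "max T1 T2" and a = "robust_low + e"
            and b = "robust_high - e" and c = "robust_low + 3 * e" and d = "robust_high - 3 * e"])
        show "pos i t < robust_low + e" if "max T1 T2 \<le> t" "i \<in> L" for t i
          using L_pos that by simp
        show "robust_low + e \<le> pos j t" if "max T1 T2 \<le> t" "j \<in> correct - L" for t j
          using not_L_pos that by simp
        show "robust_high - e < pos i t" if "max T1 T2 \<le> t" "i \<in> U" for t i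
          using U_pos that by simp
        show "pos j t \<le> robust_high - e" if "max T1 T2 \<le> t" "j \<in> correct - U" for t j
          using not_U_pos that by simp
      qed (use e gap frequently_few_high[OF e \<delta> gap many_above]
          frequently_few_low[OF e \<delta> gap many_below] in auto)
    qed
  qed
qed

lemma spread_tendsto_zero:
  assumes e: "0 < e"
  shows "\<exists>T\<ge>0. \<forall>t\<ge>T. high_max t - low_min t < e"
proof -
  interpret N: corda_run n f B \<delta> "mirror pos" look cmp mend by (rule mirror_run)
  have e2: "0 < e / 2" using e by simp
  obtain T1 where T1: "0 \<le> T1" "\<And>t. T1 \<le> t \<Longrightarrow> low_lim - e / 2 < low_min t"
    using eventually_low_min_near_low_lim[OF e2] by blast
  obtain T2 where T2: "\<And>t. T2 \<le> t \<Longrightarrow> N.low_lim - e / 2 < N.low_min t"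
    using N.eventually_low_min_near_low_lim[OF e2] by blast
  have "high_max t - low_min t < e" if "max T1 T2 \<le> t" for t
    using T1(2)[of t] T2[of t] that low_lim_eq_robust_low N.low_lim_eq_robust_low robust_low_eq_robust_high
    by simp
  then show ?thesis using T1(1) by (intro exI[of _ "max T1 T2"]) auto
qed

lemma le_high_max:
  assumes i: "i \<in> correct"
  shows "pos i t \<le> high_max t" and "dest_at n f pos look cmp i t \<le> high_max t"
proof -
  interpret N: corda_run n f B \<delta> "mirror pos" look cmp mend by (rule mirror_run)
  have "N.low_min t \<le> N.low i t" by (rule N.low_min_le[OF i])
  then show "pos i t \<le> high_max t" "dest_at n f pos look cmp i t \<le> high_max t"
    using N.low_le_pos[of i t] N.low_le_dest_at[of i t] dest_at_mirror[OF n_gt_5f, of pos look cmp i t]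
    by (simp_all add: mirror_def)
qed

lemma diamUD_le_spread: "diamUD n f B pos look cmp t \<le> high_max t - low_min t"
proof -
  define S where "S = set_mset (U_ms n B pos t + D_ms n f B pos look cmp t)"
  have S: "S = (\<lambda>i. pos i t) ` correct \<union> (\<lambda>i. dest_at n f pos look cmp i t) ` correct"
    unfolding S_def U_ms_def D_ms_def by simp
  have "finite S" "S \<noteq> {}" unfolding S using correct_nonempty by auto
  moreover have "low_min t \<le> v \<and> v \<le> high_max t" if "v \<in> S" for v
  proof -
    from \<open>v \<in> S\<close> obtain i where i: "i \<in> correct" and v: "v = pos i t \<or> v = dest_at n f pos look cmp i t"
      unfolding S by blast
    have "low_min t \<le> low i t" by (rule low_min_le[OF i])
    then show ?thesis using v low_le_pos[of i t] low_le_dest_at[of i t] le_high_max[OF i, of t] by auto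
  qed
  ultimately have "Max S \<le> high_max t" "low_min t \<le> Min S" by simp_all
  then show ?thesis unfolding diamUD_def diam_def S_def[symmetric] by simp
qed
end

theorem lemma14:
  fixes n f :: nat and B :: "nat set" and \<delta> :: "nat \<Rightarrow> real"
    and pos :: "nat \<Rightarrow> real \<Rightarrow> real" and look cmp mend :: "nat \<Rightarrow> nat \<Rightarrow> real"
  assumes "5 * f < n"
    and "B \<subseteq> {..<n}" and "card B \<le> f"
    and "corda_exec n f B \<delta> pos look cmp mend"
  shows "\<exists>\<alpha>::real. 0 < \<alpha> \<and> \<alpha> < 1 \<and>
           (\<forall>t \<ge> 0. diamUD n f B pos look cmp t > 0 \<longrightarrow>
              (\<exists>t' > t. diamUD n f B pos look cmp t' < \<alpha> * diamUD n f B pos look cmp t))"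
proof -
  interpret E: corda_run n f B \<delta> pos look cmp mend
    using assms by (unfold_locales) auto
  have "\<exists>t' > t. diamUD n f B pos look cmp t' < (1/2) * diamUD n f B pos look cmp t"
    if t: "0 \<le> t" and d: "0 < diamUD n f B pos look cmp t" for t
  proof -
    have d2: "0 < diamUD n f B pos look cmp t / 2" using d by simp
    obtain T where T: "0 \<le> T" "\<forall>t'\<ge>T. E.high_max t' - E.low_min t' < diamUD n f B pos look cmp t / 2"
      using E.spread_tendsto_zero[OF d2] by blast
    define t' where "t' = max T (t + 1)"
    have "t < t'" unfolding t'_def by simp
    moreover have "diamUD n f B pos look cmp t' < (1/2) * diamUD n f B pos look cmp t"
    proof -
      have "diamUD n f B pos look cmp t' \<le> E.high_max t' - E.low_min t'" by (rule E.diamUD_le_spread)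
      also have "\<dots> < diamUD n f B pos look cmp t / 2" using T(2) unfolding t'_def by simp
      finally show ?thesis by simp
    qed
    ultimately show ?thesis by blast
  qed
  then show ?thesis by (intro exI[of _ "1/2"]) auto
qed

end
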